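(* Let $(b,c)$ be a weighted graph over $V$ which is locally finite (each $x\in V$ has only finitely many $y$ with $b(x,y)>0$), let $m$ be a measure on $V$ and $L=L_{b,c,m}$. Assume $D_{\partial V}<\infty$. Then $\sigma_{\mathrm{ess}}(L)=\{D_{\partial V}\}$ if and only if $\alpha_{b,c,m}(\partial V)=D_{\partial V}$.
   Context: Let $V$ be a countably infinite set. A weighted graph over $V$ is a pair $(b,c)$ of maps $b:V\times V\to[0,\infty)$ and $c:V\to[0,\infty)$ with $b(x,x)=0$, $b(x,y)=b(y,x)$ and $\sum_{y\in V}b(x,y)<\infty$ for all $x,y\in V$. A measure on $V$ is a map $m:V\to(0,\infty)$. Define $Q^{\max}(u)=\frac12\sum_{x,y}b(x,y)(u(x)-u(y))^2+\sum_x c(x)u(x)^2$; $Q=Q_{b,c,m}$ is the closure in $\ell^2(V,m)$ of the restriction of $Q^{\max}$ to finitely supported functions and $L=L_{b,c,m}$ is its associated nonnegative selfadjoint operator. Let $d(x)=\frac1{m(x)}(\sum_y b(x,y)+c(x))$, $D_U=\sup_{x\in U}d(x)$. For finite $W$ let $|\partial W|=\sum_{x\in W,y\notin W}b(x,y)+\sum_{x\in W}c(x)$, $m(W)=\sum_{x\in W}m(x)$, and $\alpha_{b,c,m}(U)=\inf\{|\partial W|/m(W):\ W\subseteq U\text{ finite, nonempty}\}$. With $\mathcal K$ the net of finite subsets of $V$ directed by inclusion, set $\alpha_{b,c,m}(\partial V)=\lim_{K\in\mathcal K}\alpha_{b,c,m}(V\setminus K)$ and $D_{\partial V}=\lim_{K\in\mathcal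 K}D_{V\setminus K}$ (monotone limits). *)

theory Defs
  imports "HOL-Analysis.Analysis"
begin

definition weighted_graph :: "('v \<Rightarrow> 'v \<Rightarrow> real) \<Rightarrow> ('v \<Rightarrow> real) \<Rightarrow> bool" where
  "weighted_graph b c \<longleftrightarrow>
     (\<forall>x y. b x y \<ge> 0) \<and> (\<forall>x. c x \<ge> 0) \<and> (\<forall>x. b x x = 0) \<and>
     (\<forall>x y. b x y = b y x) \<and> (\<forall>x. (\<lambda>y. b x y) summable_on UNIV)"

definition locally_finite :: "('v \<Rightarrow> 'v \<Rightarrow> real) \<Rightarrow> bool" where
  "locally_finite b \<longleftrightarrow> (\<forall>x. finite {y. b x y > 0})"

definition vertex_measure :: "('v \<Rightarrow> real) \<Rightarrow> bool" where
  "vertex_measure m \<longleftrightarrow> (\<forall>x. m x > 0)"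

definition l2 :: "('v \<Rightarrow> real) \<Rightarrow> ('v \<Rightarrow> real) set" where
  "l2 m = {u. (\<lambda>x. m x * (u x)\<^sup>2) summable_on UNIV}"

definition l2_inner :: "('v \<Rightarrow> real) \<Rightarrow> ('v \<Rightarrow> real) \<Rightarrow> ('v \<Rightarrow> real) \<Rightarrow> real" where
  "l2_inner m u v = (\<Sum>\<^sub>\<infinity>x. m x * u x * v x)"

definition l2_norm :: "('v \<Rightarrow> real) \<Rightarrow> ('v \<Rightarrow> real) \<Rightarrow> real" where
  "l2_norm m u = sqrt (\<Sum>\<^sub>\<infinity>x. m x * (u x)\<^sup>2)"

definition fin_supp :: "('v \<Rightarrow> real) \<Rightarrow> bool" where
  "fin_supp u \<longleftrightarrow> finite {x. u x \<noteq> 0}"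

definition Qbil :: "('v \<Rightarrow> 'v \<Rightarrow> real) \<Rightarrow> ('v \<Rightarrow> real) \<Rightarrow> ('v \<Rightarrow> real) \<Rightarrow> ('v \<Rightarrow> real) \<Rightarrow> real" where
  "Qbil b c u v =
     (1/2) * (\<Sum>\<^sub>\<infinity>(x,y). b x y * (u x - u y) * (v x - v y)) + (\<Sum>\<^sub>\<infinity>x. c x * u x * v x)"

definition Qmax :: "('v \<Rightarrow> 'v \<Rightarrow> real) \<Rightarrow> ('v \<Rightarrow> real) \<Rightarrow> ('v \<Rightarrow> real) \<Rightarrow> real" where
  "Qmax b c u = (1/2) * (\<Sum>\<^sub>\<infinity>(x,y). b x y * (u x - u y)\<^sup>2) + (\<Sum>\<^sub>\<infinity>x. c x * (u x)\<^sup>2)"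

definition approx_seq :: "('v \<Rightarrow> 'v \<Rightarrow> real) \<Rightarrow> ('v \<Rightarrow> real) \<Rightarrow> ('v \<Rightarrow> real)
     \<Rightarrow> (nat \<Rightarrow> 'v \<Rightarrow> real) \<Rightarrow> ('v \<Rightarrow> real) \<Rightarrow> bool" where
  "approx_seq b c m \<phi> u \<longleftrightarrow>
     (\<forall>n. fin_supp (\<phi> n)) \<and>
     (\<lambda>n. l2_norm m (\<lambda>x. \<phi> n x - u x)) \<longlonglongrightarrow> 0 \<and>
     (\<forall>e>0. \<exists>N. \<forall>n\<ge>N. \<forall>k\<ge>N. Qmax b c (\<lambda>x. \<phi> n x - \<phi> k x) < e)"

text \<open>Domain of the closure Q of Q^max restricted to finitely supported functions.\<close>
definition form_dom :: "('v \<Rightarrow> 'v \<Rightarrow> real) \<Rightarrow> ('v \<Rightarrow> real) \<Rightarrow> ('v \<Rightarrow> real) \<Rightarrow> ('v \<Rightarrow> real) set" where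
  "form_dom b c m = {u \<in> l2 m. \<exists>\<phi>. approx_seq b c m \<phi> u}"

definition Qform :: "('v \<Rightarrow> 'v \<Rightarrow> real) \<Rightarrow> ('v \<Rightarrow> real) \<Rightarrow> ('v \<Rightarrow> real)
     \<Rightarrow> ('v \<Rightarrow> real) \<Rightarrow> ('v \<Rightarrow> real) \<Rightarrow> real" where
  "Qform b c m u v = (THE q. \<forall>\<phi> \<psi>. approx_seq b c m \<phi> u \<longrightarrow> approx_seq b c m \<psi> v \<longrightarrow>
        (\<lambda>n. Qbil b c (\<phi> n) (\<psi> n)) \<longlonglongrightarrow> q)"

definition op_dom :: "('v \<Rightarrow> 'v \<Rightarrow> real) \<Rightarrow> ('v \<Rightarrow> real) \<Rightarrow> ('v \<Rightarrow> real) \<Rightarrow> ('v \<Rightarrow> real) set" where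
  "op_dom b c m = {u \<in> form_dom b c m. \<exists>w \<in> l2 m. \<forall>v \<in> form_dom b c m. Qform b c m u v = l2_inner m w v}"

definition Lop :: "('v \<Rightarrow> 'v \<Rightarrow> real) \<Rightarrow> ('v \<Rightarrow> real) \<Rightarrow> ('v \<Rightarrow> real) \<Rightarrow> ('v \<Rightarrow> real) \<Rightarrow> ('v \<Rightarrow> real)" where
  "Lop b c m u = (THE w. w \<in> l2 m \<and> (\<forall>v \<in> form_dom b c m. Qform b c m u v = l2_inner m w v))"

text \<open>Spectrum (L is selfadjoint, so the spectrum is real; we work in the real Hilbert space).\<close>
definition spectrum_L :: "('v \<Rightarrow> 'v \<Rightarrow> real) \<Rightarrow> ('v \<Rightarrow> real) \<Rightarrow> ('v \<Rightarrow> real) \<Rightarrow> real set" where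
  "spectrum_L b c m = {t. \<not> (bij_betw (\<lambda>u x. Lop b c m u x - t * u x) (op_dom b c m) (l2 m) \<and>
        (\<exists>C. \<forall>u \<in> op_dom b c m. l2_norm m u \<le> C * l2_norm m (\<lambda>x. Lop b c m u x - t * u x)))}"

definition eigenspace_L :: "('v \<Rightarrow> 'v \<Rightarrow> real) \<Rightarrow> ('v \<Rightarrow> real) \<Rightarrow> ('v \<Rightarrow> real) \<Rightarrow> real \<Rightarrow> ('v \<Rightarrow> real) set" where
  "eigenspace_L b c m t = {u \<in> op_dom b c m. \<forall>x. Lop b c m u x = t * u x}"

definition disc_spectrum_L :: "('v \<Rightarrow> 'v \<Rightarrow> real) \<Rightarrow> ('v \<Rightarrow> real) \<Rightarrow> ('v \<Rightarrow> real) \<Rightarrow> real set" where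
  "disc_spectrum_L b c m = {t \<in> spectrum_L b c m.
      (\<exists>e>0. spectrum_L b c m \<inter> ball t e = {t}) \<and>
      eigenspace_L b c m t \<noteq> {\<lambda>x. 0} \<and>
      (\<exists>F. finite F \<and> (\<forall>u \<in> eigenspace_L b c m t. \<exists>a. u = (\<lambda>x. \<Sum>f\<in>F. a f * f x)))}"

definition ess_spectrum_L :: "('v \<Rightarrow> 'v \<Rightarrow> real) \<Rightarrow> ('v \<Rightarrow> real) \<Rightarrow> ('v \<Rightarrow> real) \<Rightarrow> real set" where
  "ess_spectrum_L b c m = spectrum_L b c m - disc_spectrum_L b c m"

definition deg :: "('v \<Rightarrow> 'v \<Rightarrow> real) \<Rightarrow> ('v \<Rightarrow> real) \<Rightarrow> ('v \<Rightarrow> real) \<Rightarrow> 'v \<Rightarrow> real" where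
  "deg b c m x = ((\<Sum>\<^sub>\<infinity>y. b x y) + c x) / m x"

definition Dsup :: "('v \<Rightarrow> 'v \<Rightarrow> real) \<Rightarrow> ('v \<Rightarrow> real) \<Rightarrow> ('v \<Rightarrow> real) \<Rightarrow> 'v set \<Rightarrow> ereal" where
  "Dsup b c m U = (SUP x\<in>U. ereal (deg b c m x))"

text \<open>Monotone (decreasing) limit along the net of finite sets = infimum.\<close>
definition D_boundary :: "('v \<Rightarrow> 'v \<Rightarrow> real) \<Rightarrow> ('v \<Rightarrow> real) \<Rightarrow> ('v \<Rightarrow> real) \<Rightarrow> ereal" where
  "D_boundary b c m = (INF K\<in>{K. finite K}. Dsup b c m (UNIV - K))"

definition boundary_size :: "('v \<Rightarrow> 'v \<Rightarrow> real) \<Rightarrow> ('v \<Rightarrow> real) \<Rightarrow> 'v set \<Rightarrow> real" where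
  "boundary_size b c W = (\<Sum>x\<in>W. \<Sum>\<^sub>\<infinity>y\<in>UNIV - W. b x y) + (\<Sum>x\<in>W. c x)"

definition alpha :: "('v \<Rightarrow> 'v \<Rightarrow> real) \<Rightarrow> ('v \<Rightarrow> real) \<Rightarrow> ('v \<Rightarrow> real) \<Rightarrow> 'v set \<Rightarrow> ereal" where
  "alpha b c m U = (INF W\<in>{W. finite W \<and> W \<noteq> {} \<and> W \<subseteq> U}.
                       ereal (boundary_size b c W / (\<Sum>x\<in>W. m x)))"

text \<open>Monotone (increasing) limit along the net of finite sets = supremum.\<close>
definition alpha_boundary :: "('v \<Rightarrow> 'v \<Rightarrow> real) \<Rightarrow> ('v \<Rightarrow> real) \<Rightarrow> ('v \<Rightarrow> real) \<Rightarrow> ereal" where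
  "alpha_boundary b c m = (SUP K\<in>{K. finite K}. alpha b c m (UNIV - K))"

end

theory Submission
  imports Defs
begin

text \<open>If \<open>D\<^sub>\<partial>\<^sub>V < \<infinity>\<close>, the vertex degrees are bounded and \<open>L\<close> is a bounded symmetric operator on all of
  \<open>\<ell>\<^sup>2(V, m)\<close>, unitarily equivalent to an operator on the unweighted \<open>\<ell>\<^sup>2(V)\<close>.

  If \<open>\<alpha>(\<partial>V) = D\<^sub>\<partial>\<^sub>V = D\<close>, then far out all degrees are close to \<open>D\<close> and every finite \<open>W\<close> has little
  total weight on its inner edges, compared with \<open>m(W)\<close>. A coarea argument turns this into smallness
  of the form of \<open>L - D\<close> on functions supported far out. By local finiteness smallness of the form
  implies smallness of the norm, so \<open>L - D\<close> behaves like a compact operator, and its essential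
  spectrum is \<open>{0}\<close>.

  Conversely, the limit \<open>\<mu>\<close> of the bottoms of the Rayleigh quotients on complements of finite sets
  belongs to the essential spectrum (Persson), and testing with indicator functions gives
  \<open>\<mu> \<le> \<alpha>(\<partial>V)\<close>. So if the essential spectrum is \<open>{D}\<close>, then \<open>D = \<mu> \<le> \<alpha>(\<partial>V) \<le> D\<close>.\<close>

section \<open>Symmetric operators\<close>

text \<open>Neither a functional calculus nor spectral projections are used; everything reduces to
  lower bounds \<open>k * norm x \<le> norm (T x)\<close>. Two obstacles shape the proof. A small
  form controls the norm only if the form has a sign, and here the sign is known, after a small
  shift, only on functions vanishing on a finite set. So positivity is spent on the single vector
  \<open>f - (1/C) *\<^sub>R S f\<close>, which local finiteness keeps among the functions where the
  sign is known. The other obstacle is that a discrete point of the spectrum is defined by isolation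
  and a finite-dimensional eigenspace, so excluding it requires that approximate eigenvectors at an
  isolated point lie close to true ones. Lower bounds for shifts of the square of the operator give
  this with an explicit constant. Vectors vanishing on ever larger finite sets take the role of
  weakly null sequences.\<close>

definition symmetric_op :: "('a::real_inner \<Rightarrow> 'a) \<Rightarrow> bool" where
  "symmetric_op T \<longleftrightarrow> (\<forall>x y. T x \<bullet> y = x \<bullet> T y)"

definition bounded_below :: "('a::real_normed_vector \<Rightarrow> 'a) \<Rightarrow> bool" where
  "bounded_below T \<longleftrightarrow> (\<exists>k>0. \<forall>x. k * norm x \<le> norm (T x))"

definition shift :: "('a::real_vector \<Rightarrow> 'a) \<Rightarrow> real \<Rightarrow> 'a \<Rightarrow> 'a" where
  "shift T t x = T x - t *\<^sub>R x"

lemma shift_shift: "shift (shift T s) t = shift T (s + t)"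
  by (simp add: shift_def fun_eq_iff scaleR_left_distrib)

lemma bounded_linear_shift: "bounded_linear T \<Longrightarrow> bounded_linear (shift T t)"
  unfolding shift_def [abs_def]
  by (intro bounded_linear_sub bounded_linear_scaleR_right)

lemma symmetric_op_shift: "symmetric_op T \<Longrightarrow> symmetric_op (shift T t)"
  by (simp add: symmetric_op_def shift_def inner_diff_left inner_diff_right)

lemma symmetric_opD: "symmetric_op T \<Longrightarrow> T x \<bullet> y = x \<bullet> T y"
  by (simp add: symmetric_op_def)

lemma symmetric_op_square: "symmetric_op T \<Longrightarrow> symmetric_op (\<lambda>x. T (T x))"
  unfolding symmetric_op_def by metis

lemma bounded_below_comp:
  assumes "bounded_below S" "bounded_below T"
  shows "bounded_below (\<lambda>x. S (T x))"
proof -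
  obtain j k where j: "j > 0" "\<And>x. j * norm x \<le> norm (S x)" and k: "k > 0" "\<And>x. k * norm x \<le> norm (T x)"
    using assms unfolding bounded_below_def by blast
  have "j * k * norm x \<le> norm (S (T x))" for x
    using mult_left_mono [OF k(2) [of x], of j] j(1) j(2) [of "T x"] by (simp only: mult.assoc) linarith
  then show ?thesis
    unfolding bounded_below_def using j(1) k(1) by (intro exI [of _ "j * k"]) auto
qed

text \<open>The free parameter \<open>B\<close> lets the constant exceed a prescribed number: a
  contraction constant below needs \<open>C\<close> above the lower bound \<open>k\<close>, and
  Persson's theorem needs it above \<open>\<bar>persson T\<bar>\<close>.\<close>

lemma bounded_linear_bound:
  assumes "bounded_linear T"
  obtains C where "C > B" "C > 0" "\<And>x. norm (T x) \<le> C * norm x"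
proof -
  obtain C where C: "C > 0" "\<And>x. norm (T x) \<le> norm x * C"
    using bounded_linear.pos_bounded [OF assms] by blast
  have "norm (T x) \<le> (max C (\<bar>B\<bar> + 1)) * norm x" for x
    using C(2) [of x] mult_right_mono [of C "max C (\<bar>B\<bar> + 1)" "norm x"] by (simp add: mult.commute)
  then show thesis
    by (intro that [of "max C (\<bar>B\<bar> + 1)"]) auto
qed

lemma norm_diff_scaleR_sq:
  "(norm (x - p *\<^sub>R y))\<^sup>2 = (norm x)\<^sup>2 - 2 * p * (x \<bullet> y) + p\<^sup>2 * (norm y)\<^sup>2"
  unfolding power2_norm_eq_inner
  by (simp add: inner_diff_left inner_diff_right inner_commute power2_eq_square algebra_simps)

text \<open>The Cauchy--Schwarz inequality for the form of \<open>S\<close>, needing positivity at one vector only.\<close>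
lemma norm_sq_le_nonneg_form:
  assumes lin: "bounded_linear S" and sym: "symmetric_op S" and C: "C > 0"
    and bound: "norm (S (S f)) \<le> C * norm (S f)"
    and pos: "0 \<le> S (f - (1/C) *\<^sub>R S f) \<bullet> (f - (1/C) *\<^sub>R S f)"
  shows "(norm (S f))\<^sup>2 \<le> C * (S f \<bullet> f)"
proof -
  interpret S: bounded_linear S by (fact lin)
  define g where "g = S f"
  have sg: "S g \<bullet> f = g \<bullet> g"
    using symmetric_opD [OF sym, of g f] by (simp add: g_def)
  have sgg: "S g \<bullet> g \<le> C * (g \<bullet> g)"
  proof -
    have "S g \<bullet> g \<le> norm (S g) * norm g"
      by (rule norm_cauchy_schwarz)
    also have "\<dots> \<le> C * norm g * norm g"
      using bound by (intro mult_right_mono) (auto simp: g_def)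
    also have "\<dots> = C * (g \<bullet> g)"
      by (simp add: dot_square_norm power2_eq_square)
    finally show ?thesis .
  qed
  \<comment> \<open>The test vector is one gradient step for the form: the linear gain is
    \<open>2 * (g \<bullet> g) / C\<close>, and \<open>sgg\<close> limits the quadratic cost to half
    of it.\<close>
  have "0 \<le> (g - (1/C) *\<^sub>R S g) \<bullet> (f - (1/C) *\<^sub>R g)"
    using pos by (simp add: S.diff S.scaleR g_def)
  also have "\<dots> = g \<bullet> f - 2 * (g \<bullet> g) / C + (S g \<bullet> g) / C\<^sup>2"
    using C by (simp add: inner_diff_left inner_diff_right sg power2_eq_square field_simps)
  also have "\<dots> \<le> g \<bullet> f - 2 * (g \<bullet> g) / C + C * (g \<bullet> g) / C\<^sup>2"
    using sgg by (simp add: divide_right_mono)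
  also have "\<dots> = g \<bullet> f - (g \<bullet> g) / C"
    using C by (simp add: power2_eq_square field_simps)
  finally show ?thesis
    using C by (simp add: g_def dot_square_norm field_simps)
qed

section \<open>Solvability and spectral gaps for symmetric operators\<close>

lemma subspace_closure_normed:
  fixes S :: "'a::real_normed_vector set"
  assumes "subspace S"
  shows "subspace (closure S)"
  unfolding subspace_def
proof (intro conjI ballI allI)
  show "0 \<in> closure S"
    using assms closure_subset subspace_0 by blast
next
  fix x y assume "x \<in> closure S" "y \<in> closure S"
  then obtain X Y where "\<And>n. X n \<in> S" "X \<longlonglongrightarrow> x" "\<And>n. Y n \<in> S" "Y \<longlonglongrightarrow> y"
    unfolding closure_sequential by blast
  then show "x + y \<in> closure S"
    unfolding closure_sequential
    by (intro exI [of _ "\<lambda>n. X n + Y n"]) (auto intro: tendsto_add subspace_add [OF assms])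
next
  fix x and c :: real assume "x \<in> closure S"
  then obtain X where "\<And>n. X n \<in> S" "X \<longlonglongrightarrow> x"
    unfolding closure_sequential by blast
  then show "c *\<^sub>R x \<in> closure S"
    unfolding closure_sequential
    by (intro exI [of _ "\<lambda>n. c *\<^sub>R X n"]) (auto intro: tendsto_scaleR subspace_scale [OF assms])
qed

text \<open>The solution is a fixed point of \<open>x + (1/C\<^sup>2) *\<^sub>R T (w - T x)\<close>.
  Symmetry gives \<open>T (T y) \<bullet> y = (norm (T y))\<^sup>2\<close>, so on \<open>M\<close>
  this map contracts by \<open>sqrt (1 - k\<^sup>2 / C\<^sup>2)\<close>. At a fixed point
  \<open>T (w - T x) = 0\<close>, and the lower bound on \<open>M\<close> removes the outer
  \<open>T\<close>. The invariant subspace \<open>M\<close> is there for an operator that has a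
  kernel but is bounded below on the closure of its range.\<close>

lemma symmetric_solve:
  fixes T :: "'a::{real_inner, complete_space} \<Rightarrow> 'a"
  assumes lin: "bounded_linear T" and sym: "symmetric_op T"
    and M: "closed M" "subspace M" "\<And>x. x \<in> M \<Longrightarrow> T x \<in> M"
    and k: "k > 0" "\<And>x. x \<in> M \<Longrightarrow> k * norm x \<le> norm (T x)"
    and w: "w \<in> M"
  shows "\<exists>h\<in>M. T h = w"
proof -
  interpret T: bounded_linear T by (fact lin)
  obtain C where C: "C > k" "C > 0" "\<And>x. norm (T x) \<le> C * norm x"
    using bounded_linear_bound [OF lin] by metis
  define q where "q = sqrt (1 - k\<^sup>2 / C\<^sup>2)"
  have kC: "k\<^sup>2 / C\<^sup>2 < 1" "0 < k\<^sup>2 / C\<^sup>2"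
    using k(1) C(1) by (auto simp: field_simps power_strict_mono)
  then have q: "0 \<le> q" "q < 1" "q\<^sup>2 = 1 - k\<^sup>2 / C\<^sup>2"
    by (auto simp: q_def)
  have contr: "norm (y - (1/C\<^sup>2) *\<^sub>R T (T y)) \<le> q * norm y" if y: "y \<in> M" for y
  proof -
    have tty: "T (T y) \<bullet> y = (norm (T y))\<^sup>2" "y \<bullet> T (T y) = (norm (T y))\<^sup>2"
      using symmetric_opD [OF sym, of "T y" y] by (auto simp: dot_square_norm inner_commute)
    have "(norm (T (T y)))\<^sup>2 \<le> C\<^sup>2 * (norm (T y))\<^sup>2"
      using power_mono [OF C(3) [of "T y"], of 2] by (simp add: power_mult_distrib)
    then have 1: "(norm (T (T y)))\<^sup>2 / C^4 \<le> (norm (T y))\<^sup>2 / C\<^sup>2"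
      using C(2) by (simp add: field_simps power4_eq_xxxx power2_eq_square)
    have 2: "k\<^sup>2 * (norm y)\<^sup>2 \<le> (norm (T y))\<^sup>2"
      using power_mono [OF k(2) [OF y], of 2] k(1) by (simp add: power_mult_distrib)
    have "(norm (y - (1/C\<^sup>2) *\<^sub>R T (T y)))\<^sup>2
        = (norm y)\<^sup>2 - 2 * (norm (T y))\<^sup>2 / C\<^sup>2 + (norm (T (T y)))\<^sup>2 / C^4"
      using norm_diff_scaleR_sq [of y "1/C\<^sup>2" "T (T y)"] tty
      by (simp add: power_divide power4_eq_xxxx power2_eq_square)
    also have "\<dots> \<le> (norm y)\<^sup>2 - (norm (T y))\<^sup>2 / C\<^sup>2"
      using 1 by simp
    also have "\<dots> \<le> (norm y)\<^sup>2 - k\<^sup>2 * (norm y)\<^sup>2 / C\<^sup>2"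
      using 2 by (simp add: divide_right_mono)
    also have "\<dots> = (q * norm y)\<^sup>2"
      by (simp add: power_mult_distrib q field_simps)
    finally show ?thesis
      by (rule power2_le_imp_le) (simp add: q(1))
  qed
  define \<phi> where "\<phi> x = x + (1/C\<^sup>2) *\<^sub>R T (w - T x)" for x
  have "\<exists>!x\<in>M. \<phi> x = x"
  proof (rule Banach_fix)
    show "complete M" using M(1) by (simp add: complete_eq_closed)
    show "M \<noteq> {}" using w by auto
    show "0 \<le> q" "q < 1" using q by auto
    show "\<phi> ` M \<subseteq> M"
      using w by (auto simp: \<phi>_def intro!: subspace_add subspace_scale subspace_diff M)
    show "dist (\<phi> x) (\<phi> y) \<le> q * dist x y" if "x \<in> M" "y \<in> M" for x y
    proof -
      have "\<phi> x - \<phi> y = (x - y) - (1/C\<^sup>2) *\<^sub>R T (T (x - y))"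
        by (simp add: \<phi>_def T.diff algebra_simps)
      then show ?thesis
        using contr [of "x - y"] that M(2) by (simp add: dist_norm subspace_diff)
    qed
  qed
  then obtain x where x: "x \<in> M" "\<phi> x = x" by blast
  then have "T (w - T x) = 0"
    using C(2) by (simp add: \<phi>_def)
  moreover have "w - T x \<in> M"
    using x w M by (simp add: subspace_diff)
  ultimately have "w - T x = 0"
    using k(1) k(2) [of "w - T x"] by (simp add: mult_le_0_iff)
  then show ?thesis using x by auto
qed

lemma bounded_below_imp_bij:
  fixes T :: "'a::{real_inner, complete_space} \<Rightarrow> 'a"
  assumes lin: "bounded_linear T" and sym: "symmetric_op T" and bb: "bounded_below T"
  shows "bij T"
proof -
  interpret T: bounded_linear T by (fact lin)
  obtain k where k: "k > 0" "\<And>x. k * norm x \<le> norm (T x)"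
    using bb unfolding bounded_below_def by blast
  have "surj T"
    unfolding surj_def using symmetric_solve [OF lin sym, of UNIV k] k by (metis UNIV_I closed_UNIV subspace_UNIV)
  moreover have "inj T"
  proof (rule injI)
    fix x y assume "T x = T y"
    then show "x = y"
      using k(1) k(2) [of "x - y"] by (simp add: T.diff mult_le_0_iff)
  qed
  ultimately show ?thesis by (simp add: bij_def)
qed

text \<open>The lower bound \<open>\<kappa>\<close> of \<open>\<parallel>S x\<parallel>\<close> on the unit sphere is attained as \<open>\<plusminus>\<kappa>\<close> in the approximate
  spectrum, because \<open>S\<^sup>2 - \<kappa>\<^sup>2 = (S - \<kappa>) (S + \<kappa>)\<close> has a nonnegative form with infimum \<open>0\<close>.\<close>
lemma norm_ge_if_shifts_bounded_below:
  fixes S :: "'a::real_inner \<Rightarrow> 'a"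
  assumes lin: "bounded_linear S" and sym: "symmetric_op S"
    and bb: "\<And>k. 0 \<le> k \<Longrightarrow> k < r \<Longrightarrow> bounded_below (shift S k) \<and> bounded_below (shift S (- k))"
  shows "r * norm x \<le> norm (S x)"
proof (rule ccontr)
  interpret S: bounded_linear S by (fact lin)
  assume neg: "\<not> r * norm x \<le> norm (S x)"
  define N where "N = (\<lambda>x. norm (S x)) ` {x. norm x = 1}"
  define k where "k = Inf N"
  have x0: "x \<noteq> 0" using neg by (auto simp: S.zero)
  define e where "e = (1 / norm x) *\<^sub>R x"
  have e: "norm e = 1" "norm (S e) < r"
    using x0 neg by (auto simp: e_def S.scaleR field_simps)
  have N: "N \<noteq> {}" "bdd_below N" "norm (S e) \<in> N"
    using e by (auto simp: N_def intro!: bdd_belowI [of _ 0])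
  have k0: "0 \<le> k" unfolding k_def using N by (intro cInf_greatest) (auto simp: N_def)
  have kr: "k < r" using cInf_lower [OF N(3,2)] e(2) by (simp add: k_def)
  have kle: "k * norm y \<le> norm (S y)" for y
  proof (cases "y = 0")
    case False
    then have "norm (S ((1 / norm y) *\<^sub>R y)) \<in> N" by (auto simp: N_def)
    from cInf_lower [OF this N(2)] show ?thesis
      using False by (simp add: k_def S.scaleR field_simps)
  qed (simp add: S.zero)
  define A where "A = shift (\<lambda>x. S (S x)) (k\<^sup>2)"
  have linA: "bounded_linear A"
    unfolding A_def by (intro bounded_linear_shift bounded_linear_compose [OF lin lin])
  have symA: "symmetric_op A"
    unfolding A_def by (intro symmetric_op_shift symmetric_op_square sym)
  have formA: "A y \<bullet> y = (norm (S y))\<^sup>2 - k\<^sup>2 * (norm y)\<^sup>2" for y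
    using symmetric_opD [OF sym, of "S y" y]
    by (simp add: A_def shift_def inner_diff_left dot_square_norm)
  have posA: "0 \<le> A y \<bullet> y" for y
    using power_mono [OF kle [of y], of 2] k0 by (simp add: formA power_mult_distrib)
  obtain C where C: "C > 0" "\<And>x. norm (A x) \<le> C * norm x"
    using bounded_linear_bound [OF linA] by metis
  have "A = (\<lambda>x. shift S k (shift S (- k) x))"
    by (simp add: A_def shift_def fun_eq_iff S.diff S.add S.scaleR algebra_simps power2_eq_square)
  with bounded_below_comp bb [OF k0 kr] have "bounded_below A" by metis
  then obtain j where j: "j > 0" "\<And>x. j * norm x \<le> norm (A x)"
    unfolding bounded_below_def by blast
  have low: "j\<^sup>2 \<le> C * ((norm (S y))\<^sup>2 - k\<^sup>2)" if "norm y = 1" for y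
  proof -
    have "j\<^sup>2 \<le> (norm (A y))\<^sup>2"
      using power_mono [OF j(2) [of y], of 2] j(1) that by simp
    also have "\<dots> \<le> C * (A y \<bullet> y)"
      using norm_sq_le_nonneg_form [OF linA symA C(1) C(2) posA] .
    finally show ?thesis using that by (simp add: formA)
  qed
  \<comment> \<open>By \<open>low\<close>, every element of \<open>N\<close> is at least this root,
    so the infimum \<open>k\<close> would exceed itself.\<close>
  have "sqrt (k\<^sup>2 + j\<^sup>2 / C) \<le> k"
    unfolding k_def
  proof (rule cInf_greatest [OF N(1)], unfold k_def [symmetric])
    fix s assume "s \<in> N"
    then obtain y where y: "norm y = 1" "s = norm (S y)" by (auto simp: N_def)
    then have "k\<^sup>2 + j\<^sup>2 / C \<le> s\<^sup>2"
      using low [OF y(1)] C(1) by (simp add: field_simps)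
    then show "sqrt (k\<^sup>2 + j\<^sup>2 / C) \<le> s"
      using y(2) by (simp add: real_le_lsqrt)
  qed
  then have "k\<^sup>2 + j\<^sup>2 / C \<le> k\<^sup>2"
    using k0 sqrt_le_D by blast
  then show False using j(1) C(1) by (simp add: field_simps power2_eq_square mult_le_0_iff)
qed

text \<open>The factorization of \<open>T\<^sup>2 - s\<close> into \<open>T - sqrt s\<close> and
  \<open>T + sqrt s\<close> keeps \<open>(0, e\<^sup>2)\<close> free of spectrum of
  \<open>T\<^sup>2\<close>. Centring this interval, with \<open>l\<close> its midpoint and radius,
  yields \<open>l * norm x \<le> norm (S x)\<close> for \<open>S = T\<^sup>2 - l\<close>. Squaring
  and expanding cancels \<open>(l * norm x)\<^sup>2\<close> and leaves the claim.\<close>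

lemma isolated_zero_gap:
  fixes T :: "'a::real_inner \<Rightarrow> 'a"
  assumes lin: "bounded_linear T" and sym: "symmetric_op T" and e: "e > 0"
    and bb: "\<And>s. 0 < \<bar>s\<bar> \<Longrightarrow> \<bar>s\<bar> < e \<Longrightarrow> bounded_below (shift T s)"
  shows "e * norm (T x) \<le> norm (T (T x))"
proof -
  interpret T: bounded_linear T by (fact lin)
  define l where "l = e\<^sup>2 / 2"
  have l: "l > 0" "2 * l = e\<^sup>2" using e by (auto simp: l_def)
  define S where "S = shift (\<lambda>x. T (T x)) l"
  have bbq: "bounded_below (shift (\<lambda>x. T (T x)) s)" if "0 < s" "s < e\<^sup>2" for s
  proof -
    have "0 < sqrt s" "sqrt s < e" 
      using that e by (auto simp: real_less_lsqrt)
    then have "bounded_below (\<lambda>x. shift T (sqrt s) (shift T (- sqrt s) x))"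
      using bounded_below_comp [OF bb [of "sqrt s"] bb [of "- sqrt s"]] by simp
    moreover have "(\<lambda>x. shift T (sqrt s) (shift T (- sqrt s) x)) = shift (\<lambda>x. T (T x)) s"
      using that by (simp add: shift_def fun_eq_iff T.diff T.add T.scaleR algebra_simps)
    ultimately show ?thesis by simp
  qed
  have "l * norm x \<le> norm (S x)"
  proof (rule norm_ge_if_shifts_bounded_below)
    show "bounded_linear S"
      unfolding S_def by (intro bounded_linear_shift bounded_linear_compose [OF lin lin])
    show "symmetric_op S"
      unfolding S_def by (intro symmetric_op_shift symmetric_op_square sym)
    fix k assume "0 \<le> k" "k < l"
    then show "bounded_below (shift S k) \<and> bounded_below (shift S (- k))"
      unfolding S_def shift_shift using l by (intro conjI bbq) auto
  qed
  then have "(l * norm x)\<^sup>2 \<le> (norm (S x))\<^sup>2"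
    using l(1) by (intro power_mono) auto
  also have "(norm (S x))\<^sup>2 = (norm (T (T x)))\<^sup>2 - 2 * l * (norm (T x))\<^sup>2 + (l * norm x)\<^sup>2"
    using symmetric_opD [OF sym, of "T x" x]
    by (simp add: S_def shift_def power2_norm_eq_inner inner_diff_left inner_diff_right
        power_mult_distrib inner_commute) (simp add: power2_eq_square)
  finally have "(e * norm (T x))\<^sup>2 \<le> (norm (T (T x)))\<^sup>2"
    using l(2) by (simp add: power_mult_distrib)
  then show ?thesis by (rule power2_le_imp_le) simp
qed

text \<open>By continuity the gap persists on the closure of the range, where \<open>T\<close> is
  thus solvable. The element \<open>h\<close> there with \<open>T h = T f\<close> differs from
  \<open>f\<close> by a kernel vector \<open>g = f - h\<close>, and the gap bounds \<open>h\<close>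
  itself. This replaces the orthogonal projection onto the kernel.\<close>

lemma near_kernel:
  fixes T :: "'a::{real_inner, complete_space} \<Rightarrow> 'a"
  assumes lin: "bounded_linear T" and sym: "symmetric_op T" and e: "e > 0"
    and gap: "\<And>x. e * norm (T x) \<le> norm (T (T x))"
  shows "\<exists>g. T g = 0 \<and> e * norm (f - g) \<le> norm (T f)"
proof -
  interpret T: bounded_linear T by (fact lin)
  let ?M = "closure (range T)"
  have gapM: "e * norm y \<le> norm (T y)" if "y \<in> ?M" for y
  proof -
    have "\<exists>Y. (\<forall>n. Y n \<in> range T) \<and> Y \<longlonglongrightarrow> y"
      using that by (simp only: closure_sequential)
    then obtain Y where Y: "\<forall>n. Y n \<in> range T" "Y \<longlonglongrightarrow> y"
      by metis
    show ?thesis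
    proof (rule LIMSEQ_le)
      show "(\<lambda>n. e * norm (Y n)) \<longlonglongrightarrow> e * norm y"
        by (intro tendsto_mult tendsto_const tendsto_norm Y(2))
      show "(\<lambda>n. norm (T (Y n))) \<longlonglongrightarrow> norm (T y)"
        by (intro tendsto_norm T.tendsto Y(2))
      have "e * norm (Y n) \<le> norm (T (Y n))" for n
        using Y(1)[THEN spec, of n] gap by auto
      then show "\<exists>N. \<forall>n\<ge>N. e * norm (Y n) \<le> norm (T (Y n))" by blast
    qed
  qed
  have "subspace (range T)"
    by (metis T.linear_axioms linear_subspace_image subspace_UNIV)
  then have sub: "subspace ?M" by (rule subspace_closure_normed)
  have ran: "T x \<in> ?M" for x
    using closure_subset [of "range T"] by blast
  obtain h where h: "h \<in> ?M" "T h = T f"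
    using symmetric_solve [OF lin sym closed_closure sub ran e gapM ran, of f] by blast
  then show ?thesis
    using gapM [OF h(1)] by (intro exI [of _ "f - h"]) (simp add: T.diff)
qed

text \<open>For a bounded symmetric operator on a complete space a lower bound already implies
  bijectivity (\<open>bounded_below_imp_bij\<close>), so this approximate point spectrum is the full
  spectrum.\<close>

definition spec :: "('a::real_normed_vector \<Rightarrow> 'a) \<Rightarrow> real set" where
  "spec T = {t. \<not> bounded_below (shift T t)}"

definition disc_spec :: "('a::real_normed_vector \<Rightarrow> 'a) \<Rightarrow> real set" where
  "disc_spec T = {t \<in> spec T. (\<exists>e>0. spec T \<inter> ball t e = {t}) \<and> {x. shift T t x = 0} \<noteq> {0} \<and>
     (\<exists>F. finite F \<and> {x. shift T t x = 0} \<subseteq> span F)}"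

definition ess_spec :: "('a::real_normed_vector \<Rightarrow> 'a) \<Rightarrow> real set" where
  "ess_spec T = spec T - disc_spec T"

lemma near_eigenspace:
  fixes T :: "'a::{real_inner, complete_space} \<Rightarrow> 'a"
  assumes lin: "bounded_linear T" and sym: "symmetric_op T" and e: "e > 0"
    and iso: "spec T \<inter> ball t e \<subseteq> {t}"
  shows "\<exists>g. shift T t g = 0 \<and> e * norm (f - g) \<le> norm (shift T t f)"
proof (rule near_kernel)
  show "bounded_linear (shift T t)" "symmetric_op (shift T t)"
    using lin sym by (auto intro: bounded_linear_shift symmetric_op_shift)
  then show "e * norm (shift T t x) \<le> norm (shift T t (shift T t x))" for x
  proof (rule isolated_zero_gap)
    fix s :: real assume s: "0 < \<bar>s\<bar>" "\<bar>s\<bar> < e"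
    then have "t + s \<in> ball t e" by (simp add: dist_real_def)
    with iso s have "t + s \<notin> spec T" by auto
    then show "bounded_below (shift (shift T t) s)"
      by (simp add: spec_def shift_shift)
  qed fact
qed fact

text \<open>Unit vectors with an explicit expansion turn near-orthogonality to finitely many vectors
  into a uniform bound over the whole span.\<close>

lemma finite_dim_orthonormal:
  fixes F :: "'a::real_inner set"
  assumes "finite F"
  obtains C where "finite C" "\<And>h. h \<in> C \<Longrightarrow> norm h = 1"
    "\<And>g. g \<in> span F \<Longrightarrow> g = (\<Sum>h\<in>C. (g \<bullet> h) *\<^sub>R h)"
proof -
  obtain B where B: "finite B" "span B = span F" "pairwise orthogonal B"
    using basis_orthogonal [OF assms] by blast
  define C where "C = (\<lambda>h. (1 / norm h) *\<^sub>R h) ` (B - {0})"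
  have finC: "finite C" and normC: "\<And>h. h \<in> C \<Longrightarrow> norm h = 1"
    using B(1) by (auto simp: C_def split: if_splits)
  have orthC: "h \<bullet> h' = 0" if hh: "h \<in> C" "h' \<in> C" "h \<noteq> h'" for h h'
  proof -
    obtain a a' where a: "a \<in> B" "a' \<in> B" "h = (1 / norm a) *\<^sub>R a" "h' = (1 / norm a') *\<^sub>R a'"
      using hh by (auto simp: C_def)
    then have "a \<noteq> a'" using hh(3) by auto
    then show ?thesis
      using a B(3) by (auto simp: pairwise_def orthogonal_def)
  qed
  have "B \<subseteq> span C"
  proof
    fix h assume h: "h \<in> B"
    show "h \<in> span C"
    proof (cases "h = 0")
      case False
      then have "(1 / norm h) *\<^sub>R h \<in> span C"
        using h by (intro span_base) (auto simp: C_def)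
      from span_scale [OF this, of "norm h"] show ?thesis using False by simp
    qed (simp add: span_zero)
  qed
  then have sp: "span F \<subseteq> span C"
    using B(2) span_mono [of B "span C"] by (simp add: span_span)
  have "g = (\<Sum>h\<in>C. (g \<bullet> h) *\<^sub>R h)" if "g \<in> span F" for g
  proof -
    have "g \<in> span C" using sp that by blast
    then obtain u where u: "g = (\<Sum>h\<in>C. u h *\<^sub>R h)"
      unfolding span_finite [OF finC] by auto
    have "g \<bullet> h = u h" if h: "h \<in> C" for h
    proof -
      have "g \<bullet> h = (\<Sum>a\<in>C. u a * (a \<bullet> h))"
        by (simp add: u inner_sum_left)
      also have "\<dots> = (\<Sum>a\<in>C. if a = h then u h else 0)"
        using orthC [OF _ h] normC [OF h] by (intro sum.cong) (auto simp: dot_square_norm)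
      finally show ?thesis using finC h by simp
    qed
    then have "(\<Sum>h\<in>C. (g \<bullet> h) *\<^sub>R h) = (\<Sum>h\<in>C. u h *\<^sub>R h)" by simp
    then show ?thesis using u by simp
  qed
  with finC normC show thesis by (rule that)
qed

section \<open>The Hilbert space of square summable functions\<close>

lemma sq_summable_add:
  fixes f g :: "'a \<Rightarrow> real"
  assumes "(\<lambda>x. (f x)\<^sup>2) summable_on A" "(\<lambda>x. (g x)\<^sup>2) summable_on A"
  shows "(\<lambda>x. (f x + g x)\<^sup>2) summable_on A"
proof (rule summable_on_comparison_test)
  show "(\<lambda>x. 2 * (f x)\<^sup>2 + 2 * (g x)\<^sup>2) summable_on A"
    by (intro summable_on_add summable_on_cmult_right assms)
  show "(f x + g x)\<^sup>2 \<le> 2 * (f x)\<^sup>2 + 2 * (g x)\<^sup>2" for x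
    using sum_squares_bound [of "f x" "g x"] by (simp add: power2_sum)
qed auto

lemma sq_summable_mult:
  fixes f g :: "'a \<Rightarrow> real"
  assumes "(\<lambda>x. (f x)\<^sup>2) summable_on A" "(\<lambda>x. (g x)\<^sup>2) summable_on A"
  shows "(\<lambda>x. f x * g x) summable_on A"
proof -
  have "(\<lambda>x. \<bar>f x * g x\<bar>) summable_on A"
  proof (rule summable_on_comparison_test)
    show "(\<lambda>x. (f x)\<^sup>2 + (g x)\<^sup>2) summable_on A"
      by (intro summable_on_add assms)
    show "\<bar>f x * g x\<bar> \<le> (f x)\<^sup>2 + (g x)\<^sup>2" for x
    proof -
      have "2 * (\<bar>f x\<bar> * \<bar>g x\<bar>) \<le> (f x)\<^sup>2 + (g x)\<^sup>2"
        using sum_squares_bound [of "\<bar>f x\<bar>" "\<bar>g x\<bar>"] by simp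
      moreover have "0 \<le> \<bar>f x\<bar> * \<bar>g x\<bar>" by simp
      ultimately show ?thesis unfolding abs_mult by linarith
    qed
  qed auto
  then show ?thesis
    by (subst summable_on_iff_abs_summable_on_real) simp
qed

text \<open>A type cannot depend on the measure \<open>m\<close>, so the space is unweighted; the
  factor \<open>sqrt (m x)\<close> is put into the embedding of the weighted space. As a type in
  \<open>real_inner\<close> and \<open>complete_space\<close> it admits the operator lemmas
  above.\<close>

typedef 'a ell2 = "{f :: 'a \<Rightarrow> real. (\<lambda>x. (f x)\<^sup>2) summable_on UNIV}"
  morphisms coord mk_ell2
  by (rule exI [of _ "\<lambda>_. 0"]) simp

setup_lifting type_definition_ell2

instantiation ell2 :: (type) real_inner
begin

lift_definition zero_ell2 :: "'a ell2" is "\<lambda>_. 0" by simp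

lift_definition plus_ell2 :: "'a ell2 \<Rightarrow> 'a ell2 \<Rightarrow> 'a ell2" is "\<lambda>f g x. f x + g x"
  by (rule sq_summable_add)

lift_definition uminus_ell2 :: "'a ell2 \<Rightarrow> 'a ell2" is "\<lambda>f x. - f x" by simp

lift_definition minus_ell2 :: "'a ell2 \<Rightarrow> 'a ell2 \<Rightarrow> 'a ell2" is "\<lambda>f g x. f x - g x"
  subgoal for f g using sq_summable_add [of f UNIV "\<lambda>x. - g x"] by simp
  done

lift_definition scaleR_ell2 :: "real \<Rightarrow> 'a ell2 \<Rightarrow> 'a ell2" is "\<lambda>r f x. r * f x"
  by (simp add: power_mult_distrib summable_on_cmult_right)

definition inner_ell2 :: "'a ell2 \<Rightarrow> 'a ell2 \<Rightarrow> real" where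
  "inner_ell2 f g = (\<Sum>\<^sub>\<infinity>x. coord f x * coord g x)"

definition norm_ell2 :: "'a ell2 \<Rightarrow> real" where
  "norm_ell2 f = sqrt (f \<bullet> f)"

definition dist_ell2 :: "'a ell2 \<Rightarrow> 'a ell2 \<Rightarrow> real" where
  "dist_ell2 f g = norm (f - g)"

definition sgn_ell2 :: "'a ell2 \<Rightarrow> 'a ell2" where
  "sgn_ell2 f = scaleR (inverse (norm f)) f"

definition uniformity_ell2 :: "('a ell2 \<times> 'a ell2) filter" where
  "uniformity_ell2 = (INF e\<in>{0<..}. principal {(f, g). dist f g < e})"

definition open_ell2 :: "'a ell2 set \<Rightarrow> bool" where
  "open_ell2 U \<longleftrightarrow> (\<forall>f\<in>U. eventually (\<lambda>(f', g). f' = f \<longrightarrow> g \<in> U) uniformity)"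

lemma coord_sq_summable: "(\<lambda>x. (coord f x)\<^sup>2) summable_on UNIV"
  using coord [of f] by simp

lemma coord_mult_summable: "(\<lambda>x. coord f x * coord g x) summable_on UNIV"
  by (rule sq_summable_mult [OF coord_sq_summable coord_sq_summable])

instance
proof
  fix a b c :: "'a ell2" and r s :: real
  show "a + b + c = a + (b + c)" "a + b = b + a" "0 + a = a" "- a + a = 0" "a - b = a + - b"
    "r *\<^sub>R (a + b) = r *\<^sub>R a + r *\<^sub>R b" "(r + s) *\<^sub>R a = r *\<^sub>R a + s *\<^sub>R a"
    "r *\<^sub>R s *\<^sub>R a = (r * s) *\<^sub>R a" "1 *\<^sub>R a = a"
    by (transfer; simp add: algebra_simps)+
  show "dist a b = norm (a - b)" "sgn a = scaleR (inverse (norm a)) a" "norm a = sqrt (a \<bullet> a)"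
    by (simp_all add: dist_ell2_def sgn_ell2_def norm_ell2_def)
  show "uniformity = (INF e\<in>{0<..}. principal {(f, g :: 'a ell2). dist f g < e})"
    by (simp add: uniformity_ell2_def)
  show "open U \<longleftrightarrow> (\<forall>f\<in>U. eventually (\<lambda>(f', g). f' = f \<longrightarrow> g \<in> U) uniformity)" for U :: "'a ell2 set"
    by (simp add: open_ell2_def)
  show "a \<bullet> b = b \<bullet> a"
    by (simp add: inner_ell2_def mult.commute)
  show "(a + b) \<bullet> c = a \<bullet> c + b \<bullet> c"
    by (simp add: inner_ell2_def plus_ell2.rep_eq distrib_right infsum_add coord_mult_summable)
  show "r *\<^sub>R a \<bullet> b = r * (a \<bullet> b)"
    by (simp add: inner_ell2_def scaleR_ell2.rep_eq mult.assoc infsum_cmult_right')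
  show "0 \<le> a \<bullet> a"
    by (simp add: inner_ell2_def infsum_nonneg)
  show "a \<bullet> a = 0 \<longleftrightarrow> a = 0"
  proof
    assume "a \<bullet> a = 0"
    then have "coord a x * coord a x = 0" for x
      using nonneg_infsum_le_0D [of "\<lambda>x. coord a x * coord a x" UNIV x] coord_mult_summable [of a a]
      by (simp add: inner_ell2_def)
    then show "a = 0"
      by (intro coord_inject [THEN iffD1]) (simp add: fun_eq_iff zero_ell2.rep_eq)
  qed (simp add: inner_ell2_def zero_ell2.rep_eq)
qed

end

lemmas coord_simps [simp] =
  zero_ell2.rep_eq plus_ell2.rep_eq uminus_ell2.rep_eq minus_ell2.rep_eq scaleR_ell2.rep_eq

lemma ell2_eqI: "(\<And>x. coord f x = coord g x) \<Longrightarrow> f = g"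
  by (simp add: coord_inject [symmetric] fun_eq_iff)

lemma norm_ell2_sq: "(norm f)\<^sup>2 = (\<Sum>\<^sub>\<infinity>x. (coord f x)\<^sup>2)"
  unfolding power2_norm_eq_inner inner_ell2_def by (simp add: power2_eq_square)

lemma sum_coord_sq_le: "finite F \<Longrightarrow> (\<Sum>x\<in>F. (coord f x)\<^sup>2) \<le> (norm f)\<^sup>2"
  unfolding norm_ell2_sq by (intro finite_sum_le_infsum coord_sq_summable) auto

lemma norm_ell2_sq_leI:
  assumes "\<And>F. finite F \<Longrightarrow> (\<Sum>x\<in>F. (coord f x)\<^sup>2) \<le> B"
  shows "(norm f)\<^sup>2 \<le> B"
  unfolding norm_ell2_sq by (intro infsum_le_finite_sums coord_sq_summable assms)

lemma abs_coord_le_norm: "\<bar>coord f x\<bar> \<le> norm f"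
  using sum_coord_sq_le [of "{x}" f] by (auto intro: power2_le_imp_le)

lemma bounded_linear_coord: "bounded_linear (\<lambda>f. coord f x)"
  by (rule bounded_linear_intro [of _ 1]) (auto simp: abs_coord_le_norm)

lemma sq_summable_if_bounded:
  fixes f :: "'a \<Rightarrow> real"
  assumes "\<And>F. finite F \<Longrightarrow> (\<Sum>x\<in>F. (f x)\<^sup>2) \<le> B"
  shows "(\<lambda>x. (f x)\<^sup>2) summable_on UNIV"
  using assms by (intro nonneg_bounded_partial_sums_imp_summable_on [of _ _ B])
    (auto simp: eventually_finite_subsets_at_top)

instance ell2 :: (type) complete_space
proof
  fix X :: "nat \<Rightarrow> 'a ell2"
  assume X: "Cauchy X"
  have "Cauchy (\<lambda>n. coord (X n) x)" for x
    by (rule bounded_linear.Cauchy [OF bounded_linear_coord X])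
  then have "\<exists>l. (\<lambda>n. coord (X n) x) \<longlonglongrightarrow> l" for x
    using Cauchy_convergent unfolding convergent_def by blast
  then obtain g where g: "\<And>x. (\<lambda>n. coord (X n) x) \<longlonglongrightarrow> g x" by metis
  \<comment> \<open>Finite partial sums are used because the pointwise limit \<open>g\<close> is not
    yet known to be square summable; the bound at one index then proves that it is.\<close>
  have *: "\<exists>N. \<forall>n\<ge>N. \<forall>F. finite F \<longrightarrow> (\<Sum>x\<in>F. (coord (X n) x - g x)\<^sup>2) \<le> e\<^sup>2" if e: "e > 0" for e
  proof -
    obtain N where N: "\<And>n k. n \<ge> N \<Longrightarrow> k \<ge> N \<Longrightarrow> norm (X n - X k) < e"
      using X e unfolding Cauchy_def dist_norm by blast
    have "(\<Sum>x\<in>F. (coord (X n) x - g x)\<^sup>2) \<le> e\<^sup>2" if n: "n \<ge> N" and F: "finite F" for n F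
    proof (rule LIMSEQ_le_const2)
      show "(\<lambda>k. \<Sum>x\<in>F. (coord (X n) x - coord (X k) x)\<^sup>2) \<longlonglongrightarrow> (\<Sum>x\<in>F. (coord (X n) x - g x)\<^sup>2)"
        by (intro tendsto_sum tendsto_power tendsto_diff tendsto_const g)
      have "(\<Sum>x\<in>F. (coord (X n) x - coord (X k) x)\<^sup>2) \<le> e\<^sup>2" if "k \<ge> N" for k
      proof -
        have "(\<Sum>x\<in>F. (coord (X n) x - coord (X k) x)\<^sup>2) \<le> (norm (X n - X k))\<^sup>2"
          using sum_coord_sq_le [OF F, of "X n - X k"] by simp
        also have "\<dots> \<le> e\<^sup>2"
          using N [OF n that] by (intro power_mono) auto
        finally show ?thesis .
      qed
      then show "\<exists>N. \<forall>k\<ge>N. (\<Sum>x\<in>F. (coord (X n) x - coord (X k) x)\<^sup>2) \<le> e\<^sup>2" by blast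
    qed
    then show ?thesis by blast
  qed
  obtain N where "\<And>F. finite F \<Longrightarrow> (\<Sum>x\<in>F. (coord (X N) x - g x)\<^sup>2) \<le> 1\<^sup>2"
    using * [of 1] by auto
  then have "(\<lambda>x. (coord (X N) x - g x)\<^sup>2) summable_on UNIV"
    by (rule sq_summable_if_bounded)
  then have "(\<lambda>x. (coord (X N) x + - (coord (X N) x - g x))\<^sup>2) summable_on UNIV"
    by (intro sq_summable_add coord_sq_summable) (simp add: power2_commute)
  then have "coord (mk_ell2 g) = g"
    by (simp add: mk_ell2_inverse)
  then have "\<exists>N. \<forall>n\<ge>N. norm (X n - mk_ell2 g) < e" if e: "e > 0" for e
  proof -
    obtain N where N: "\<And>n F. n \<ge> N \<Longrightarrow> finite F \<Longrightarrow> (\<Sum>x\<in>F. (coord (X n) x - g x)\<^sup>2) \<le> (e/2)\<^sup>2"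
      using * [OF half_gt_zero [OF e]] by blast
    have "norm (X n - mk_ell2 g) \<le> e/2" if "n \<ge> N" for n
      using N [OF that] \<open>e > 0\<close> \<open>coord (mk_ell2 g) = g\<close>
      by (intro power2_le_imp_le [OF norm_ell2_sq_leI]) auto
    then show ?thesis using e by (intro exI [of _ N]) fastforce
  qed
  then show "convergent X"
    unfolding convergent_def LIMSEQ_iff by blast
qed

section \<open>Truncations, point masses and functions vanishing on a set\<close>

lift_definition cut :: "'a set \<Rightarrow> 'a ell2 \<Rightarrow> 'a ell2" is "\<lambda>K f x. if x \<in> K then f x else 0"
  by (erule summable_on_comparison_test) auto

lemmas coord_cut [simp] = cut.rep_eq

lift_definition delta :: "'a \<Rightarrow> 'a ell2" is "\<lambda>y x. if x = y then 1 else 0"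
  subgoal for y
    by (rule finite_nonzero_values_imp_summable_on) (rule finite_subset [of _ "{y}"], auto)
  done

lemmas coord_delta [simp] = delta.rep_eq

text \<open>For finite \<open>K\<close> this is the precise meaning of being supported far out. It
  is a subspace, shrinks as \<open>K\<close> grows, and contains a point mass for each vertex
  outside \<open>K\<close>.\<close>

definition vanish :: "'a set \<Rightarrow> 'a ell2 set" where
  "vanish K = {f. \<forall>x\<in>K. coord f x = 0}"

lemma subspace_vanish: "subspace (vanish K)"
  by (auto simp: vanish_def subspace_def)

lemma vanish_antimono: "K \<subseteq> K' \<Longrightarrow> vanish K' \<subseteq> vanish K"
  by (auto simp: vanish_def)

lemma delta_nonzero [simp]: "delta x \<noteq> 0"
proof
  assume "delta x = 0"
  then have "coord (delta x) x = 0" by (simp only: coord_simps)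
  then show False by simp
qed

lemma delta_vanish: "x \<notin> K \<Longrightarrow> delta x \<in> vanish K"
  by (auto simp: vanish_def)

lemma linear_cut: "linear (cut K)"
  by (rule linearI) (auto intro: ell2_eqI)

lemma cut_split: "f = cut K f + cut (- K) f"
  by (rule ell2_eqI) auto

lemma cut_finite: "finite K \<Longrightarrow> cut K f = (\<Sum>x\<in>K. coord f x *\<^sub>R delta x)"
proof (rule ell2_eqI)
  fix y assume K: "finite K"
  have "coord (\<Sum>x\<in>K. coord f x *\<^sub>R delta x) y = (\<Sum>x\<in>K. coord f x * (if y = x then 1 else 0))"
    by (simp add: bounded_linear.linear [OF bounded_linear_coord, THEN linear_sum])
  also have "\<dots> = (if y \<in> K then coord f y else 0)"
    using K by (simp add: if_distrib [of "\<lambda>z. _ * z"] cong: if_cong)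
  finally show "coord (cut K f) y = coord (\<Sum>x\<in>K. coord f x *\<^sub>R delta x) y" by simp
qed

lemma norm_cut_tail:
  assumes "e > 0"
  shows "\<exists>K. finite K \<and> norm (cut (- K) f) \<le> e"
proof -
  obtain K where K: "finite K" "dist (\<Sum>x\<in>K. (coord f x)\<^sup>2) (\<Sum>\<^sub>\<infinity>x. (coord f x)\<^sup>2) \<le> e\<^sup>2"
    using infsum_finite_approximation [OF coord_sq_summable [of f], of "e\<^sup>2"] assms by auto
  have "(\<Sum>x\<in>F. (coord (cut (- K) f) x)\<^sup>2) \<le> e\<^sup>2" if F: "finite F" for F
  proof -
    have "(\<Sum>x\<in>F. (coord (cut (- K) f) x)\<^sup>2) = (\<Sum>x\<in>F - K. (coord f x)\<^sup>2)"
      using F by (intro sum.mono_neutral_cong_right) auto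
    also have "\<dots> = (\<Sum>x\<in>F \<union> K. (coord f x)\<^sup>2) - (\<Sum>x\<in>K. (coord f x)\<^sup>2)"
      using F K(1) sum.union_disjoint [of "F - K" K "\<lambda>x. (coord f x)\<^sup>2"] by (simp add: Int_commute)
    also have "\<dots> \<le> (\<Sum>\<^sub>\<infinity>x. (coord f x)\<^sup>2) - (\<Sum>x\<in>K. (coord f x)\<^sup>2)"
      using sum_coord_sq_le [of "F \<union> K" f] F K(1) by (simp add: norm_ell2_sq)
    also have "\<dots> \<le> e\<^sup>2"
      using K(2) by (simp add: dist_real_def)
    finally show ?thesis .
  qed
  then have "norm (cut (- K) f) \<le> e"
    using assms by (intro power2_le_imp_le [OF norm_ell2_sq_leI]) auto
  with K(1) show ?thesis by blast
qed

lemma inner_vanish_le: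
  assumes "f \<in> vanish K"
  shows "\<bar>f \<bullet> h\<bar> \<le> norm f * norm (cut (- K) h)"
proof -
  have "f \<bullet> h = f \<bullet> cut (- K) h"
    unfolding inner_ell2_def using assms by (intro infsum_cong) (auto simp: vanish_def)
  then show ?thesis using Cauchy_Schwarz_ineq2 by metis
qed

section \<open>Essential spectrum\<close>

lemma spec_approx:
  fixes T :: "'a::real_normed_vector \<Rightarrow> 'a"
  assumes lin: "bounded_linear T" and s: "s \<in> spec T" and e: "e > 0"
  shows "\<exists>f. norm f = 1 \<and> norm (shift T s f) < e"
proof -
  interpret S: bounded_linear "shift T s" by (intro bounded_linear_shift lin)
  obtain x where x: "norm (shift T s x) < e * norm x"
    using s e unfolding spec_def bounded_below_def by (auto simp: not_le)
  then have "x \<noteq> 0" by (auto simp: S.zero)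
  with x show ?thesis
    by (intro exI [of _ "(1 / norm x) *\<^sub>R x"]) (simp add: S.scaleR field_simps)
qed

text \<open>A finite-dimensional eigenspace is almost orthogonal to every vector
  that vanishes on a large finite set.\<close>
lemma weyl_ess_spec:
  fixes T :: "'a ell2 \<Rightarrow> 'a ell2"
  assumes lin: "bounded_linear T" and sym: "symmetric_op T"
    and weyl: "\<And>e K. e > 0 \<Longrightarrow> finite K \<Longrightarrow>
      \<exists>f. f \<noteq> 0 \<and> f \<in> vanish K \<and> norm (shift T t f) \<le> e * norm f"
  shows "t \<in> ess_spec T"
proof -
  have spec: "t \<in> spec T"
    unfolding spec_def mem_Collect_eq
  proof
    assume "bounded_below (shift T t)"
    then obtain k where k: "k > 0" "\<And>x. k * norm x \<le> norm (shift T t x)"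
      unfolding bounded_below_def by blast
    obtain f where "f \<noteq> 0" "norm (shift T t f) \<le> (k/2) * norm f"
      using weyl [of "k/2" "{}"] k(1) by auto
    with k(2) [of f] have "k * norm f \<le> (k/2) * norm f" by linarith
    then show False using \<open>f \<noteq> 0\<close> k(1) by simp
  qed
  have "t \<notin> disc_spec T"
  proof
    assume "t \<in> disc_spec T"
    then obtain e F where e: "e > 0" "spec T \<inter> ball t e = {t}"
      and F: "finite F" "{x. shift T t x = 0} \<subseteq> span F"
      unfolding disc_spec_def by blast
    obtain C where C: "finite C" "\<And>h. h \<in> C \<Longrightarrow> norm h = 1"
      "\<And>g. g \<in> span F \<Longrightarrow> g = (\<Sum>h\<in>C. (g \<bullet> h) *\<^sub>R h)"
      using finite_dim_orthonormal [OF F(1)] by metis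
    \<comment> \<open>Chosen so that the \<open>card C\<close> terms of the expansion of
      \<open>f \<bullet> g\<close>, each at most \<open>norm g * (norm f * d)\<close>, add up to at
      most half of \<open>norm g * norm f\<close>; the \<open>+ 1\<close> covers empty
      \<open>C\<close>.\<close>
    define d where "d = 1 / (2 * (real (card C) + 1))"
    have d: "d > 0" "real (card C) * d \<le> 1/2"
      by (auto simp: d_def field_simps)
    obtain K where K: "\<And>h. finite (K h)" "\<And>h :: 'a ell2. norm (cut (- K h) h) \<le> d"
      using norm_cut_tail [OF d(1)] by metis
    obtain f where f: "f \<noteq> 0" "f \<in> vanish (\<Union>h\<in>C. K h)" "norm (shift T t f) \<le> (e/2) * norm f"
      using weyl [of "e/2" "\<Union>h\<in>C. K h"] e(1) C(1) K(1) by auto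
    obtain g where g: "shift T t g = 0" "e * norm (f - g) \<le> norm (shift T t f)"
      using near_eigenspace [OF lin sym e(1)] e(2) by blast
    have close: "norm (f - g) \<le> norm f / 2"
    proof -
      have "e * norm (f - g) \<le> e * (norm f / 2)" using g(2) f(3) by simp
      then show ?thesis using e(1) by (simp only: mult_le_cancel_left_pos)
    qed
    have inner_h: "\<bar>f \<bullet> h\<bar> \<le> norm f * d" if "h \<in> C" for h
    proof -
      have "f \<in> vanish (K h)" using f(2) vanish_antimono [of "K h" "\<Union>h\<in>C. K h"] that by blast
      from inner_vanish_le [OF this, of h] show ?thesis
        using mult_left_mono [OF K(2) [of h], of "norm f"] by simp
    qed
    have "g \<in> span F" using F(2) g(1) by blast
    then have "f \<bullet> g = f \<bullet> (\<Sum>h\<in>C. (g \<bullet> h) *\<^sub>R h)" using C(3) [of g] by simp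
    also have "\<dots> = (\<Sum>h\<in>C. (g \<bullet> h) * (f \<bullet> h))" by (simp add: inner_sum_right)
    also have "\<dots> \<le> (\<Sum>h\<in>C. norm g * (norm f * d))"
    proof (rule sum_mono)
      fix h assume h: "h \<in> C"
      have "(g \<bullet> h) * (f \<bullet> h) \<le> \<bar>g \<bullet> h\<bar> * \<bar>f \<bullet> h\<bar>"
        by (metis abs_ge_self abs_mult)
      also have "\<dots> \<le> norm g * (norm f * d)"
        using inner_h [OF h] Cauchy_Schwarz_ineq2 [of g h] C(2) [OF h] by (intro mult_mono) auto
      finally show "(g \<bullet> h) * (f \<bullet> h) \<le> norm g * (norm f * d)" .
    qed
    also have "\<dots> = (real (card C) * d) * (norm g * norm f)" by simp
    also have "\<dots> \<le> 1/2 * (norm g * norm f)"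
      using d(2) by (intro mult_right_mono) auto
    \<comment> \<open>Near-orthogonality forces \<open>(norm (f - g))\<^sup>2\<close> to be at least
      half of \<open>(norm f)\<^sup>2\<close>, whereas \<open>close\<close> allows only a
      quarter.\<close>
    finally have "2 * (f \<bullet> g) \<le> norm g * norm f" by simp
    moreover have "(norm (f - g))\<^sup>2 = (norm f)\<^sup>2 - 2 * (f \<bullet> g) + (norm g)\<^sup>2"
      using norm_diff_scaleR_sq [of f 1 g] by simp
    moreover have "(norm (f - g))\<^sup>2 \<le> (norm f)\<^sup>2 / 4"
      using power_mono [OF close, of 2] by (simp add: power_divide)
    moreover have "2 * (norm g * norm f) \<le> (norm f)\<^sup>2 + (norm g)\<^sup>2"
      using sum_squares_bound [of "norm g" "norm f"] by simp
    moreover have "0 \<le> (norm g)\<^sup>2" by simp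
    moreover have "0 < (norm f)\<^sup>2" using f(1) by simp
    ultimately show False by linarith
  qed
  with spec show ?thesis by (simp add: ess_spec_def)
qed

section \<open>Spectrum away from the value at infinity\<close>

lemma finite_coords_convergent_subseq:
  fixes f :: "nat \<Rightarrow> 'a ell2"
  assumes "finite K" and bdd: "\<And>n. norm (f n) \<le> B"
  shows "\<exists>r l. strict_mono r \<and> (\<forall>x\<in>K. (\<lambda>n. coord (f (r n)) x) \<longlonglongrightarrow> l x)"
  using assms(1)
proof (induction K)
  case empty
  show ?case by (intro exI [of _ id] exI) (simp add: strict_mono_def)
next
  case (insert y K)
  then obtain r l where r: "strict_mono r" "\<And>x. x \<in> K \<Longrightarrow> (\<lambda>n. coord (f (r n)) x) \<longlonglongrightarrow> l x"
    by blast
  have "bounded (range (\<lambda>n. coord (f (r n)) y))"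
    using bdd abs_coord_le_norm [of "f (r _)" y] by (intro boundedI [of _ B]) (auto intro: order_trans)
  then obtain a q where q: "strict_mono q" "((\<lambda>n. coord (f (r n)) y) \<circ> q) \<longlonglongrightarrow> a"
    using bounded_imp_convergent_subsequence by blast
  have "(\<lambda>n. coord (f ((r \<circ> q) n)) x) \<longlonglongrightarrow> (l(y := a)) x" if "x \<in> insert y K" for x
  proof (cases "x = y")
    case True
    then show ?thesis using q(2) by (simp add: o_def)
  next
    case False
    then show ?thesis
      using LIMSEQ_subseq_LIMSEQ [OF r(2) [of x] q(1)] that by (simp add: o_def)
  qed
  with strict_mono_o [OF r(1) q(1)] show ?case by blast
qed

text \<open>By \<open>vanishes_at_infinity T D\<close>, \<open>T - D\<close> is a norm limit of operators of the form
  \<open>A + R\<close> with \<open>R\<close> of finite rank, hence compact if \<open>T\<close> is symmetric.\<close>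
definition vanishes_at_infinity :: "('a ell2 \<Rightarrow> 'a ell2) \<Rightarrow> real \<Rightarrow> bool" where
  "vanishes_at_infinity T D \<longleftrightarrow>
     (\<forall>d>0. \<exists>K. finite K \<and> (\<forall>f\<in>vanish K. norm (shift T D f) \<le> d * norm f))"

lemma vanishes_at_infinityD:
  "vanishes_at_infinity T D \<Longrightarrow> d > 0 \<Longrightarrow>
     \<exists>K. finite K \<and> (\<forall>f\<in>vanish K. norm (shift T D f) \<le> d * norm f)"
  by (simp add: vanishes_at_infinity_def)

text \<open>Far out \<open>T\<close> deviates from \<open>D\<close> by at most half of
  \<open>\<bar>s - D\<bar>\<close>, so the other half remains as a lower bound for
  \<open>T - s\<close>.\<close>

lemma vanishes_at_infinity_bound:
  assumes "vanishes_at_infinity T D" "s \<noteq> D"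
  obtains K d where "finite K" "d > 0" "\<And>h. h \<in> vanish K \<Longrightarrow> d * norm h \<le> norm (shift T s h)"
proof -
  define d where "d = \<bar>s - D\<bar> / 2"
  have d: "d > 0" "\<bar>s - D\<bar> = 2 * d" using assms(2) by (auto simp: d_def)
  obtain K where K: "finite K" "\<And>f. f \<in> vanish K \<Longrightarrow> norm (shift T D f) \<le> d * norm f"
    using vanishes_at_infinityD [OF assms(1) d(1)] by metis
  have "d * norm h \<le> norm (shift T s h)" if "h \<in> vanish K" for h
  proof -
    have "(s - D) *\<^sub>R h = shift T D h - shift T s h"
      by (simp add: shift_def scaleR_left_diff_distrib)
    then have "\<bar>s - D\<bar> * norm h \<le> norm (shift T D h) + norm (shift T s h)"
      by (metis norm_scaleR norm_triangle_ineq4)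
    with K(2) [OF that] d(2) show ?thesis by (simp add: algebra_simps)
  qed
  with K(1) d(1) show thesis by (intro that)
qed

text \<open>This is the compactness argument. The part of \<open>f n\<close> on the finite set
  \<open>K\<close> has a convergent subsequence, so \<open>shift T s\<close> of the remaining part
  \<open>h n\<close> converges along it as well. The lower bound on \<open>vanish K\<close> then
  makes \<open>h\<close> itself a Cauchy sequence.\<close>

lemma approx_eigenvectors_convergent:
  fixes T :: "'a ell2 \<Rightarrow> 'a ell2"
  assumes lin: "bounded_linear T" and van: "vanishes_at_infinity T D" "s \<noteq> D"
    and f: "\<And>n. norm (f n) = 1" "(\<lambda>n. shift T s (f n)) \<longlonglongrightarrow> 0"
  shows "\<exists>r u. strict_mono r \<and> (f \<circ> r) \<longlonglongrightarrow> u \<and> norm u = 1 \<and> shift T s u = 0"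
proof -
  interpret S: bounded_linear "shift T s" by (intro bounded_linear_shift lin)
  obtain K d where K: "finite K" "d > 0" "\<And>h. h \<in> vanish K \<Longrightarrow> d * norm h \<le> norm (shift T s h)"
    using vanishes_at_infinity_bound [OF van] by metis
  obtain r l where r: "strict_mono r" "\<And>x. x \<in> K \<Longrightarrow> (\<lambda>n. coord (f (r n)) x) \<longlonglongrightarrow> l x"
    using finite_coords_convergent_subseq [OF K(1), of f 1] f(1) by auto
  define p where "p = (\<Sum>x\<in>K. l x *\<^sub>R delta x)"
  have p: "(\<lambda>n. cut K (f (r n))) \<longlonglongrightarrow> p"
    unfolding cut_finite [OF K(1)] p_def by (intro tendsto_sum tendsto_scaleR r(2) tendsto_const)
  define h where "h n = cut (- K) (f (r n))" for n
  have fh: "f (r n) = cut K (f (r n)) + h n" for n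
    unfolding h_def by (rule cut_split)
  have "(\<lambda>n. shift T s (f (r n)) - shift T s (cut K (f (r n)))) \<longlonglongrightarrow> 0 - shift T s p"
    using LIMSEQ_subseq_LIMSEQ [OF f(2) r(1)] by (intro tendsto_diff S.tendsto p) (simp add: o_def)
  moreover have "shift T s (f (r n)) - shift T s (cut K (f (r n))) = shift T s (h n)" for n
    by (subst fh) (simp add: S.add)
  ultimately have Sh: "Cauchy (\<lambda>n. shift T s (h n))"
    by (simp add: LIMSEQ_imp_Cauchy)
  have "Cauchy h"
    unfolding Cauchy_def
  proof (intro allI impI)
    fix e :: real assume e: "e > 0"
    with K(2) obtain N where N: "\<And>n k. n \<ge> N \<Longrightarrow> k \<ge> N \<Longrightarrow> dist (shift T s (h n)) (shift T s (h k)) < d * e"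
      using Sh unfolding Cauchy_def by (meson mult_pos_pos)
    have "dist (h n) (h k) < e" if "n \<ge> N" "k \<ge> N" for n k
    proof -
      have "h n - h k \<in> vanish K" by (simp add: h_def vanish_def)
      then have "d * norm (h n - h k) < d * e"
        using K(3) [of "h n - h k"] N [OF that] by (simp add: S.diff dist_norm)
      then show ?thesis using K(2) by (simp add: dist_norm)
    qed
    then show "\<exists>N. \<forall>n\<ge>N. \<forall>k\<ge>N. dist (h n) (h k) < e" by blast
  qed
  then obtain h0 where "h \<longlonglongrightarrow> h0"
    using Cauchy_convergent unfolding convergent_def by blast
  with p have "(\<lambda>n. cut K (f (r n)) + h n) \<longlonglongrightarrow> p + h0" by (rule tendsto_add)
  then have u: "(f \<circ> r) \<longlonglongrightarrow> p + h0" by (simp add: o_def flip: fh)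
  have "norm (p + h0) = 1"
    using LIMSEQ_unique [OF tendsto_norm [OF u]] f(1) by simp
  moreover have "shift T s (p + h0) = 0"
    using LIMSEQ_unique [OF S.tendsto [OF u]] LIMSEQ_subseq_LIMSEQ [OF f(2) r(1)] by (simp add: o_def)
  ultimately show ?thesis using r(1) u by blast
qed

lemma spec_eigenvector:
  fixes T :: "'a ell2 \<Rightarrow> 'a ell2"
  assumes lin: "bounded_linear T" and van: "vanishes_at_infinity T D" "s \<noteq> D" and s: "s \<in> spec T"
  shows "\<exists>u. norm u = 1 \<and> shift T s u = 0"
proof -
  have "\<exists>f. norm f = 1 \<and> norm (shift T s f) < inverse (real (Suc n))" for n
    using spec_approx [OF lin s] by simp
  then obtain f where f: "\<And>n. norm (f n) = 1" "\<And>n. norm (shift T s (f n)) < inverse (real (Suc n))"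
    by metis
  have "(\<lambda>n. norm (shift T s (f n))) \<longlonglongrightarrow> 0"
    by (rule tendsto_sandwich [OF _ _ tendsto_const LIMSEQ_inverse_real_of_nat])
      (use f(2) in \<open>auto intro!: always_eventually less_imp_le\<close>)
  then have "(\<lambda>n. shift T s (f n)) \<longlonglongrightarrow> 0" by (simp add: tendsto_norm_zero_iff)
  with approx_eigenvectors_convergent [OF lin van, of f] f(1) show ?thesis by blast
qed

text \<open>Spectral points accumulating at \<open>s\<close> would be eigenvalues different from
  \<open>s\<close>. A limit \<open>u\<close> of their unit eigenvectors is an eigenvector for
  \<open>s\<close>, hence orthogonal to each of them by symmetry, and therefore to itself.\<close>

lemma spec_isolated:
  fixes T :: "'a ell2 \<Rightarrow> 'a ell2"
  assumes lin: "bounded_linear T" and sym: "symmetric_op T"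
    and van: "vanishes_at_infinity T D" "s \<noteq> D"
  shows "\<exists>e>0. spec T \<inter> ball s e \<subseteq> {s}"
proof (rule ccontr)
  assume neg: "\<not> ?thesis"
  \<comment> \<open>The cap \<open>\<bar>s - D\<bar>\<close> keeps every \<open>t n\<close> away
    from \<open>D\<close>, where spectral points need not be eigenvalues.\<close>
  define e where "e n = min \<bar>s - D\<bar> (inverse (real (Suc n)))" for n
  have "e n > 0" for n using van(2) by (simp add: e_def)
  with neg have "\<exists>t. t \<in> spec T \<and> t \<in> ball s (e n) \<and> t \<noteq> s" for n by blast
  then obtain t where t: "\<And>n. t n \<in> spec T" "\<And>n. t n \<in> ball s (e n)" "\<And>n. t n \<noteq> s" by metis
  have te: "\<bar>s - t n\<bar> < e n" for n using t(2) [of n] by (simp add: dist_real_def)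
  have "t n \<noteq> D" for n using te [of n] by (auto simp: e_def)
  then have "\<exists>u. norm u = 1 \<and> shift T (t n) u = 0" for n
    using spec_eigenvector [OF lin van(1) _ t(1)] by blast
  then obtain f where f: "\<And>n. norm (f n) = 1" "\<And>n. shift T (t n) (f n) = 0" by metis
  then have Tf: "T (f n) = t n *\<^sub>R f n" for n by (simp add: shift_def)
  have "(\<lambda>n. norm (shift T s (f n))) \<longlonglongrightarrow> 0"
  proof (rule tendsto_sandwich [OF _ _ tendsto_const LIMSEQ_inverse_real_of_nat])
    have "norm (shift T s (f n)) \<le> inverse (real (Suc n))" for n
    proof -
      have "shift T s (f n) = (t n - s) *\<^sub>R f n"
        by (simp add: shift_def Tf scaleR_left_diff_distrib)
      then show ?thesis using te [of n] f(1) [of n] by (simp add: e_def abs_minus_commute)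
    qed
    then show "\<forall>\<^sub>F n in sequentially. norm (shift T s (f n)) \<le> inverse (real (Suc n))"
      by (intro always_eventually allI)
  qed auto
  then have "(\<lambda>n. shift T s (f n)) \<longlonglongrightarrow> 0" by (simp add: tendsto_norm_zero_iff)
  then obtain r u where u: "(f \<circ> r) \<longlonglongrightarrow> u" "norm u = 1" "shift T s u = 0"
    using approx_eigenvectors_convergent [OF lin van, of f] f(1) by blast
  have "f n \<bullet> u = 0" for n
  proof -
    have "t n * (f n \<bullet> u) = s * (f n \<bullet> u)"
      using symmetric_opD [OF sym, of "f n" u] u(3) by (simp add: Tf shift_def)
    then show ?thesis using t(3) [of n] by simp
  qed
  moreover have "(\<lambda>n. (f \<circ> r) n \<bullet> u) \<longlonglongrightarrow> u \<bullet> u"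
    by (intro tendsto_inner u(1) tendsto_const)
  ultimately have "u \<bullet> u = 0" by (simp add: LIMSEQ_const_iff)
  with u(2) show False by auto
qed

text \<open>The lower bound on \<open>vanish K\<close> leaves no nonzero eigenvector that vanishes
  on \<open>K\<close>. So restriction to \<open>K\<close> is injective on the eigenspace and maps a
  basis to an independent set in the span of finitely many point masses.\<close>

lemma eigenspace_finite_dim:
  fixes T :: "'a ell2 \<Rightarrow> 'a ell2"
  assumes lin: "bounded_linear T" and van: "vanishes_at_infinity T D" "s \<noteq> D"
  shows "\<exists>F. finite F \<and> {x. shift T s x = 0} \<subseteq> span F"
proof -
  interpret S: bounded_linear "shift T s" by (intro bounded_linear_shift lin)
  define E where "E = {x. shift T s x = 0}"
  obtain K d where K: "finite K" "d > 0" "\<And>h. h \<in> vanish K \<Longrightarrow> d * norm h \<le> norm (shift T s h)"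
    using vanishes_at_infinity_bound [OF van] by metis
  obtain B where B: "B \<subseteq> E" "independent B" "E \<subseteq> span B"
    using maximal_independent_subset [of E] by metis
  have subE: "subspace E"
    unfolding E_def by (rule linear_subspace_kernel) (rule S.linear_axioms)
  have spanB: "span B \<subseteq> E" using B(1) subE by (rule span_minimal)
  have inj: "inj_on (cut K) (span B)"
  proof (rule inj_onI)
    fix f g assume fg: "f \<in> span B" "g \<in> span B" "cut K f = cut K g"
    then have E0: "f - g \<in> E" using spanB subspace_diff [OF subE] by blast
    have "coord f x = coord g x" if "x \<in> K" for x
      using arg_cong [OF fg(3), of "\<lambda>h. coord h x"] that by simp
    then have "f - g \<in> vanish K" by (simp add: vanish_def)
    then have "norm (f - g) = 0"
      using K(2) K(3) [of "f - g"] E0 by (simp add: E_def mult_le_0_iff)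
    then show "f = g" by simp
  qed
  have "cut K ` B \<subseteq> span (delta ` K)"
    unfolding cut_finite [OF K(1), abs_def] by (auto intro!: span_sum span_scale intro: span_base)
  moreover have "independent (cut K ` B)"
    using linear_independent_injective_image [OF linear_cut B(2) inj] .
  ultimately have "finite (cut K ` B)"
    using independent_span_bound [of "delta ` K" "cut K ` B"] K(1) by simp
  moreover have "inj_on (cut K) B" using inj inj_on_subset span_superset by blast
  ultimately have "finite B" using finite_imageD by blast
  with B(3) show ?thesis unfolding E_def by blast
qed

lemma spec_subset_disc_spec:
  fixes T :: "'a ell2 \<Rightarrow> 'a ell2"
  assumes "bounded_linear T" "symmetric_op T" and van: "vanishes_at_infinity T D" "s \<noteq> D"
    and s: "s \<in> spec T"
  shows "s \<in> disc_spec T"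
proof -
  obtain e where "e > 0" "spec T \<inter> ball s e \<subseteq> {s}"
    using spec_isolated [OF assms(1-4)] by blast
  moreover have "s \<in> spec T \<inter> ball s e" using s \<open>e > 0\<close> by simp
  ultimately have "\<exists>e>0. spec T \<inter> ball s e = {s}" by blast
  moreover have "{x. shift T s x = 0} \<noteq> {0}"
    using spec_eigenvector [OF assms(1,3,4,5)] by force
  ultimately show ?thesis
    using eigenspace_finite_dim [OF assms(1,3,4)] s unfolding disc_spec_def by blast
qed

lemma ess_spec_if_vanishes_at_infinity:
  fixes T :: "'a ell2 \<Rightarrow> 'a ell2"
  assumes lin: "bounded_linear T" and sym: "symmetric_op T" and van: "vanishes_at_infinity T D"
    and inf: "infinite (UNIV :: 'a set)"
  shows "ess_spec T = {D}"
proof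
  show "ess_spec T \<subseteq> {D}"
    using spec_subset_disc_spec [OF lin sym van] by (auto simp: ess_spec_def)
  have "D \<in> ess_spec T"
  proof (rule weyl_ess_spec [OF lin sym])
    fix e :: real and K :: "'a set" assume e: "e > 0" and K: "finite K"
    obtain K' where K': "finite K'" "\<And>f. f \<in> vanish K' \<Longrightarrow> norm (shift T D f) \<le> e * norm f"
      using vanishes_at_infinityD [OF van e] by metis
    obtain x where x: "x \<notin> K \<union> K'"
      using inf K K'(1) ex_new_if_finite [of "K \<union> K'"] by blast
    then show "\<exists>f. f \<noteq> 0 \<and> f \<in> vanish K \<and> norm (shift T D f) \<le> e * norm f"
      by (intro exI [of _ "delta x"] conjI delta_nonzero delta_vanish K'(2)) auto
  qed
  then show "{D} \<subseteq> ess_spec T" by simp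
qed

text \<open>The operator-theoretic content of local finiteness: far-out support is preserved, at the
  price of a larger finite set. It is needed to apply a form inequality known only on
  \<open>vanish K\<close> to vectors that involve \<open>T f\<close>.\<close>

definition local_op :: "('a ell2 \<Rightarrow> 'a ell2) \<Rightarrow> bool" where
  "local_op T \<longleftrightarrow> (\<forall>K. finite K \<longrightarrow> (\<exists>K'. finite K' \<and> K \<subseteq> K' \<and> T ` vanish K' \<subseteq> vanish K))"

lemma local_opD:
  "local_op T \<Longrightarrow> finite K \<Longrightarrow> \<exists>K'. finite K' \<and> K \<subseteq> K' \<and> T ` vanish K' \<subseteq> vanish K"
  by (simp add: local_op_def)

lemma local_op_shift: 
  assumes "local_op T"
  shows "local_op (shift T t)"
  unfolding local_op_def
proof (intro allI impI)
  fix K :: "'a set" assume "finite K"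
  then obtain K' where K': "finite K'" "K \<subseteq> K'" "T ` vanish K' \<subseteq> vanish K"
    using local_opD [OF assms] by metis
  have "shift T t f \<in> vanish K" if "f \<in> vanish K'" for f
    unfolding shift_def
    using that K'(3) vanish_antimono [OF K'(2)]
    by (intro subspace_diff subspace_scale subspace_vanish) auto
  with K' show "\<exists>K'. finite K' \<and> K \<subseteq> K' \<and> shift T t ` vanish K' \<subseteq> vanish K" by blast
qed

text \<open>Taking \<open>f\<close> in the smaller space \<open>vanish K'\<close> puts both
  \<open>f\<close> and \<open>S f\<close> into \<open>vanish K\<close>, so the one test vector at
  which positivity is required lies where \<open>pos\<close> applies.\<close>

lemma local_norm_sq_le_form:
  fixes S :: "'a ell2 \<Rightarrow> 'a ell2"
  assumes "bounded_linear S" "symmetric_op S" "local_op S"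
    and C: "C > 0" "\<And>f. norm (S f) \<le> C * norm f" and K: "finite K"
    and pos: "\<And>f. f \<in> vanish K \<Longrightarrow> 0 \<le> S f \<bullet> f"
  shows "\<exists>K'. finite K' \<and> K \<subseteq> K' \<and> (\<forall>f\<in>vanish K'. (norm (S f))\<^sup>2 \<le> C * (S f \<bullet> f))"
proof -
  obtain K' where K': "finite K'" "K \<subseteq> K'" "S ` vanish K' \<subseteq> vanish K"
    using local_opD [OF assms(3) K] by metis
  have "(norm (S f))\<^sup>2 \<le> C * (S f \<bullet> f)" if "f \<in> vanish K'" for f
  proof (rule norm_sq_le_nonneg_form [OF assms(1,2) C])
    show "0 \<le> S (f - (1 / C) *\<^sub>R S f) \<bullet> (f - (1 / C) *\<^sub>R S f)"
      using that K'(3) vanish_antimono [OF K'(2)]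
      by (intro pos subspace_diff subspace_scale subspace_vanish) auto
  qed
  with K' show ?thesis by blast
qed

text \<open>The form of \<open>T - D\<close> may take both signs. Adding \<open>a\<close> makes it
  nonnegative far out and at most \<open>2 * a * (norm f)\<^sup>2\<close>, so the local inequality
  bounds the norm of \<open>T - D + a\<close>; removing \<open>a\<close> again costs at most
  \<open>d/2\<close>.\<close>

lemma vanishes_at_infinity_if_form:
  fixes T :: "'a ell2 \<Rightarrow> 'a ell2"
  assumes lin: "bounded_linear T" and sym: "symmetric_op T" and loc: "local_op T"
    and form: "\<And>d. d > 0 \<Longrightarrow> \<exists>K. finite K \<and> (\<forall>f\<in>vanish K. \<bar>shift T D f \<bullet> f\<bar> \<le> d * (norm f)\<^sup>2)"
  shows "vanishes_at_infinity T D"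
  unfolding vanishes_at_infinity_def
proof (intro allI impI)
  fix d :: real assume d: "d > 0"
  let ?S = "shift T D"
  obtain C0 where C0: "C0 > 0" "\<And>f. norm (?S f) \<le> C0 * norm f"
    using bounded_linear_bound [OF bounded_linear_shift [OF lin]] by metis
  \<comment> \<open>\<open>C\<close> must bound \<open>T - D + a\<close> before \<open>a\<close> is
    chosen, hence the summand \<open>d\<close>, which exceeds \<open>a\<close>. The second entry of
    the minimum gives \<open>2 * C * a \<le> (d/2)\<^sup>2\<close>.\<close>
  define C where "C = C0 + d"
  define a where "a = min (d/2) (d\<^sup>2 / (8 * C))"
  have C: "C > 0" using C0(1) d by (simp add: C_def)
  then have a: "a > 0" "a \<le> d/2" "2 * C * a \<le> (d/2)\<^sup>2"
    using d by (auto simp: a_def min_def field_simps power2_eq_square)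
  have CS: "norm (shift ?S (- a) f) \<le> C * norm f" for f
  proof -
    have "norm (shift ?S (- a) f) \<le> norm (?S f) + a * norm f"
      unfolding shift_def [of ?S] using norm_triangle_ineq [of "?S f" "a *\<^sub>R f"] a(1) by simp
    also have "\<dots> \<le> C * norm f"
      using C0(2) [of f] a(2) d mult_right_mono [of a d "norm f"] by (simp add: C_def distrib_right)
    finally show ?thesis .
  qed
  obtain K where K: "finite K" "\<And>f. f \<in> vanish K \<Longrightarrow> \<bar>?S f \<bullet> f\<bar> \<le> a * (norm f)\<^sup>2"
    using form [OF a(1)] by blast
  have form_eq: "shift ?S (- a) f \<bullet> f = ?S f \<bullet> f + a * (norm f)\<^sup>2" for f
    by (simp add: shift_def [of ?S] inner_add_left power2_norm_eq_inner)
  obtain K' where K': "finite K'" "K \<subseteq> K'"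
    "\<And>f. f \<in> vanish K' \<Longrightarrow> (norm (shift ?S (- a) f))\<^sup>2 \<le> C * (shift ?S (- a) f \<bullet> f)"
  proof -
    have "\<exists>K'. finite K' \<and> K \<subseteq> K' \<and>
        (\<forall>f\<in>vanish K'. (norm (shift ?S (- a) f))\<^sup>2 \<le> C * (shift ?S (- a) f \<bullet> f))"
    proof (rule local_norm_sq_le_form)
      show "0 \<le> shift ?S (- a) f \<bullet> f" if "f \<in> vanish K" for f
        using K(2) [OF that] by (simp add: form_eq)
    qed (intro bounded_linear_shift symmetric_op_shift local_op_shift lin sym loc C CS K(1))+
    then show thesis using that by blast
  qed
  have "norm (?S f) \<le> d * norm f" if f: "f \<in> vanish K'" for f
  proof -
    have "f \<in> vanish K" using f K'(2) vanish_antimono by blast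
    then have "shift ?S (- a) f \<bullet> f \<le> 2 * a * (norm f)\<^sup>2"
      using K(2) [of f] by (simp add: form_eq)
    then have "C * (shift ?S (- a) f \<bullet> f) \<le> C * (2 * a * (norm f)\<^sup>2)"
      using C by (intro mult_left_mono) auto
    also have "\<dots> \<le> (d/2)\<^sup>2 * (norm f)\<^sup>2"
      using mult_right_mono [OF a(3), of "(norm f)\<^sup>2"] by (simp add: mult_ac)
    finally have "(norm (shift ?S (- a) f))\<^sup>2 \<le> (d/2 * norm f)\<^sup>2"
      using K'(3) [OF f] by (simp only: power_mult_distrib)
    then have 1: "norm (shift ?S (- a) f) \<le> d/2 * norm f"
      by (rule power2_le_imp_le) (use d in simp)
    have "?S f = shift ?S (- a) f - a *\<^sub>R f" by (simp add: shift_def [of ?S])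
    then have "norm (?S f) \<le> norm (shift ?S (- a) f) + norm (a *\<^sub>R f)"
      by (metis norm_triangle_ineq4)
    also have "norm (a *\<^sub>R f) \<le> d/2 * norm f"
      using a(1) mult_right_mono [OF a(2), of "norm f"] by simp
    finally show ?thesis using 1 by simp
  qed
  with K'(1) show "\<exists>K. finite K \<and> (\<forall>f\<in>vanish K. norm (?S f) \<le> d * norm f)" by blast
qed

section \<open>Persson's theorem\<close>

definition rayleigh :: "('a ell2 \<Rightarrow> 'a ell2) \<Rightarrow> 'a set \<Rightarrow> real set" where
  "rayleigh T K = (\<lambda>f. T f \<bullet> f) ` {f \<in> vanish K. norm f = 1}"

text \<open>By Persson's theorem this is the bottom of the essential spectrum.\<close>
definition persson :: "('a ell2 \<Rightarrow> 'a ell2) \<Rightarrow> real" where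
  "persson T = (SUP K\<in>{K. finite K}. Inf (rayleigh T K))"

context
  fixes T :: "'a ell2 \<Rightarrow> 'a ell2"
  assumes lin: "bounded_linear T" and inf: "infinite (UNIV :: 'a set)"
begin

lemma rayleigh_bound:
  obtains C where "C > 0" "\<And>K r. r \<in> rayleigh T K \<Longrightarrow> \<bar>r\<bar> \<le> C"
proof -
  obtain C where C: "C > 0" "\<And>f. norm (T f) \<le> C * norm f"
    using bounded_linear_bound [OF lin] by metis
  have "\<bar>T f \<bullet> f\<bar> \<le> C" if "norm f = 1" for f
    using Cauchy_Schwarz_ineq2 [of "T f" f] C(2) [of f] that by simp
  then show thesis using C(1) that [of C] by (auto simp: rayleigh_def)
qed

lemma bdd_below_rayleigh: "bdd_below (rayleigh T K)"
proof -
  obtain C where "\<And>r. r \<in> rayleigh T K \<Longrightarrow> \<bar>r\<bar> \<le> C" using rayleigh_bound by metis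
  then show ?thesis by (intro bdd_belowI [of _ "- C"]) force
qed

lemma normalized_rayleigh:
  assumes "f \<in> vanish K" "f \<noteq> 0"
  shows "(T f \<bullet> f) / (norm f)\<^sup>2 \<in> rayleigh T K"
proof -
  interpret T: bounded_linear T by (fact lin)
  define g where "g = (1 / norm f) *\<^sub>R f"
  have "g \<in> vanish K" "norm g = 1"
    using assms by (auto simp: g_def subspace_scale [OF subspace_vanish])
  moreover have "T g \<bullet> g = (T f \<bullet> f) / (norm f)\<^sup>2"
    by (simp add: g_def T.scaleR power2_eq_square)
  ultimately show ?thesis unfolding rayleigh_def by (metis (mono_tags, lifting) imageI mem_Collect_eq)
qed

lemma rayleigh_nonempty: "finite K \<Longrightarrow> rayleigh T K \<noteq> {}"
  using normalized_rayleigh [OF delta_vanish delta_nonzero] ex_new_if_finite [OF inf] by blast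

lemma Inf_rayleigh_form_le: "f \<in> vanish K \<Longrightarrow> Inf (rayleigh T K) * (norm f)\<^sup>2 \<le> T f \<bullet> f"
proof (cases "f = 0")
  case True
  then show ?thesis by simp
next
  case False
  assume "f \<in> vanish K"
  from cInf_lower [OF normalized_rayleigh [OF this False] bdd_below_rayleigh]
  show ?thesis using False by (simp add: field_simps)
qed

lemma bdd_above_persson: "bdd_above ((\<lambda>K. Inf (rayleigh T K)) ` {K. finite K})"
proof -
  obtain C where C: "\<And>K r. r \<in> rayleigh T K \<Longrightarrow> \<bar>r\<bar> \<le> C" using rayleigh_bound by metis
  have "Inf (rayleigh T K) \<le> C" if K: "finite K" for K
  proof -
    obtain r where "r \<in> rayleigh T K" using rayleigh_nonempty [OF K] by blast
    with C [OF this] cInf_lower [OF this bdd_below_rayleigh] show ?thesis by simp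
  qed
  then show ?thesis by (intro bdd_aboveI [of _ C]) auto
qed

lemma Inf_rayleigh_le_persson: "finite K \<Longrightarrow> Inf (rayleigh T K) \<le> persson T"
  unfolding persson_def by (rule cSUP_upper [OF _ bdd_above_persson]) simp

lemma Inf_rayleigh_mono: "K \<subseteq> K' \<Longrightarrow> finite K' \<Longrightarrow> Inf (rayleigh T K) \<le> Inf (rayleigh T K')"
  using vanish_antimono [of K K']
  by (intro cInf_superset_mono rayleigh_nonempty bdd_below_rayleigh) (auto simp: rayleigh_def)

lemma persson_le:
  assumes "\<And>K. finite K \<Longrightarrow> \<exists>f\<in>vanish K. f \<noteq> 0 \<and> T f \<bullet> f \<le> a * (norm f)\<^sup>2"
  shows "persson T \<le> a"
  unfolding persson_def
proof (rule cSUP_least)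
  fix K :: "'a set" assume "K \<in> {K. finite K}"
  then obtain f where f: "f \<in> vanish K" "f \<noteq> 0" "T f \<bullet> f \<le> a * (norm f)\<^sup>2"
    using assms [of K] by blast
  then have "Inf (rayleigh T K) * (norm f)\<^sup>2 \<le> a * (norm f)\<^sup>2"
    using Inf_rayleigh_form_le [OF f(1)] by linarith
  then show "Inf (rayleigh T K) \<le> a" using f(2) by simp
qed auto

text \<open>Beyond a large finite set the bottom \<open>l\<close> of the form is within
  \<open>a\<close> of \<open>persson T\<close>, so \<open>T - l\<close> is nonnegative there.
  Vectors still farther out nearly attain this bottom, and the local inequality turns a small form
  value into an approximate eigenvector. Their supports avoid any given \<open>K\<close>, as Weyl's
  criterion requires.\<close>

lemma persson_in_ess_spec:
  assumes sym: "symmetric_op T" and loc: "local_op T"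
  shows "persson T \<in> ess_spec T"
proof (rule weyl_ess_spec [OF lin sym])
  fix e :: real and K :: "'a set" assume e: "e > 0" and K: "finite K"
  let ?l = "\<lambda>K. Inf (rayleigh T K)"
  obtain C0 where C0: "C0 > 0" "\<And>f. norm (T f) \<le> C0 * norm f" and "C0 > \<bar>persson T\<bar>"
    using bounded_linear_bound [OF lin] by metis
  \<comment> \<open>This bounds \<open>T - l\<close> for every possible \<open>l\<close>, since
    \<open>\<bar>l\<bar>\<close> is at most \<open>C0 + e\<close>; \<open>a\<close> can therefore be
    fixed before \<open>l\<close>.\<close>
  define C where "C = 2 * C0 + e"
  have C: "C > 0" using C0 e by (simp add: C_def)
  define a where "a = min (e/2) (e\<^sup>2 / (8 * C))"
  have a: "a > 0" "a \<le> e/2" "2 * C * a \<le> (e/2)\<^sup>2"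
    using C e by (auto simp: a_def min_def field_simps power2_eq_square)
  obtain K0 where K0: "finite K0" "persson T - a < ?l K0"
    using less_cSUP_iff [OF _ bdd_above_persson, of "persson T - a"] a(1)
    unfolding persson_def by auto
  define K1 where "K1 = K \<union> K0"
  define l where "l = ?l K1"
  have K1: "finite K1" using K K0 by (simp add: K1_def)
  have l: "persson T - a < l" "l \<le> persson T"
    using K0(2) Inf_rayleigh_mono [of K0 K1] K1 Inf_rayleigh_le_persson [OF K1]
    by (auto simp: l_def K1_def)
  define S where "S = shift T l"
  have formS: "S f \<bullet> f = T f \<bullet> f - l * (norm f)\<^sup>2" for f
    by (simp add: S_def shift_def inner_diff_left power2_norm_eq_inner)
  have normS: "norm (S f) \<le> C * norm f" for f
  proof -
    have "norm (S f) \<le> norm (T f) + \<bar>l\<bar> * norm f"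
      unfolding S_def shift_def using norm_triangle_ineq4 [of "T f" "l *\<^sub>R f"] by simp
    also have "\<dots> \<le> C0 * norm f + (C0 + e) * norm f"
      using l a(2) \<open>C0 > \<bar>persson T\<bar>\<close> e
      by (intro add_mono mult_right_mono C0(2)) auto
    finally show ?thesis by (simp add: C_def algebra_simps)
  qed
  have "\<exists>K'. finite K' \<and> K1 \<subseteq> K' \<and> (\<forall>f\<in>vanish K'. (norm (S f))\<^sup>2 \<le> C * (S f \<bullet> f))"
  proof (rule local_norm_sq_le_form)
    show "0 \<le> S f \<bullet> f" if "f \<in> vanish K1" for f
      using Inf_rayleigh_form_le [OF that] by (simp add: formS l_def)
  qed (unfold S_def, (intro bounded_linear_shift symmetric_op_shift local_op_shift lin sym loc C
      normS [unfolded S_def] K1)+)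
  then obtain K' where K': "finite K'" "K1 \<subseteq> K'"
    "\<And>f. f \<in> vanish K' \<Longrightarrow> (norm (S f))\<^sup>2 \<le> C * (S f \<bullet> f)" by blast
  \<comment> \<open>Enlarging \<open>K1\<close> to \<open>K'\<close> removes test vectors, but no
    bottom exceeds the supremum \<open>persson T\<close>, so near-minimizers remain.\<close>
  have "?l K' < persson T + a"
    using Inf_rayleigh_le_persson [OF K'(1)] a(1) by simp
  then obtain f where f: "f \<in> vanish K'" "norm f = 1" "T f \<bullet> f < persson T + a"
    using cInf_less_iff [OF rayleigh_nonempty [OF K'(1)] bdd_below_rayleigh] by (auto simp: rayleigh_def)
  have "C * (S f \<bullet> f) \<le> C * (2 * a)"
    using f l C by (intro mult_left_mono) (auto simp: formS)
  also have "\<dots> \<le> (e/2)\<^sup>2" using a(3) by (simp add: mult_ac)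
  finally have "(norm (S f))\<^sup>2 \<le> (e/2)\<^sup>2" using K'(3) [OF f(1)] by simp
  then have 1: "norm (S f) \<le> e/2" by (rule power2_le_imp_le) (use e in simp)
  have "shift T (persson T) f = S f - (persson T - l) *\<^sub>R f"
    by (simp add: S_def shift_def scaleR_left_diff_distrib)
  then have "norm (shift T (persson T) f) \<le> norm (S f) + \<bar>persson T - l\<bar> * norm f"
    by (metis norm_scaleR norm_triangle_ineq4)
  also have "\<dots> \<le> e * norm f"
    using 1 l a(2) f(2) by simp
  finally show "\<exists>f. f \<noteq> 0 \<and> f \<in> vanish K \<and> norm (shift T (persson T) f) \<le> e * norm f"
    using f(1,2) K'(2) vanish_antimono [of K K'] by (intro exI [of _ f]) (auto simp: K1_def)
qed

end

section \<open>The graph Laplacian on l2\<close>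

locale bounded_graph =
  fixes b :: "'v \<Rightarrow> 'v \<Rightarrow> real" and c m :: "'v \<Rightarrow> real" and M :: real
  assumes graph: "weighted_graph b c" and loc_fin: "locally_finite b" and meas: "vertex_measure m"
    and deg_le: "deg b c m x \<le> M"
begin

definition nbr :: "'v \<Rightarrow> 'v set" where
  "nbr x = {y. b x y > 0}"

definition wt :: "'v \<Rightarrow> real" where
  "wt x = (\<Sum>y\<in>nbr x. b x y)"

lemma b_nonneg [simp]: "0 \<le> b x y"
  and c_nonneg [simp]: "0 \<le> c x"
  and b_diag [simp]: "b x x = 0"
  and b_sym: "b x y = b y x"
  and b_summable: "b x summable_on UNIV"
  using graph unfolding weighted_graph_def by auto

lemma m_pos [simp]: "0 < m x"
  using meas by (simp add: vertex_measure_def)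

lemma m_simps [simp]: "m x \<noteq> 0" "0 \<le> m x" "sqrt (m x) * sqrt (m x) = m x"
  using m_pos [of x] by (auto simp del: m_pos)

lemma finite_nbr [simp]: "finite (nbr x)"
  using loc_fin by (simp add: locally_finite_def nbr_def)

lemma b_eq_0: "y \<notin> nbr x \<Longrightarrow> b x y = 0"
  using b_nonneg [of x y] unfolding nbr_def by (auto simp del: b_nonneg)

lemma has_sum_nbr: "((\<lambda>y. b x y * h y) has_sum (\<Sum>y\<in>nbr x. b x y * h y)) UNIV"
  by (rule has_sum_finite_neutralI) (auto simp: b_eq_0)

lemma infsum_b: "(\<Sum>\<^sub>\<infinity>y. b x y) = wt x"
  using infsumI [OF has_sum_nbr [of x "\<lambda>_. 1"]] by (simp add: wt_def)

lemma deg_eq: "wt x + c x = deg b c m x * m x"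
  by (simp add: deg_def infsum_b)

lemma wt_nonneg [simp]: "0 \<le> wt x"
  by (simp add: wt_def sum_nonneg)

lemma deg_nonneg [simp]: "0 \<le> deg b c m x"
  by (simp add: deg_def infsum_b)

lemma M_nonneg: "0 \<le> M"
  using deg_nonneg deg_le order_trans by blast

lemma wt_c_le: "wt x + c x \<le> M * m x"
  using deg_le [of x] by (simp add: deg_eq)

lemma wt_le: "wt x \<le> M * m x"
  using wt_c_le [of x] c_nonneg [of x] by linarith

lemma c_le: "c x \<le> M * m x"
  using wt_c_le [of x] wt_nonneg [of x] by linarith

lemma sum_b_le: "finite F \<Longrightarrow> (\<Sum>y\<in>F. b x y) \<le> wt x"
  using finite_sum_le_infsum [OF b_summable, of F x] by (simp add: infsum_b)

text \<open>Multiplication by \<open>sqrt m\<close> is the unitary map from the weighted to the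
  unweighted space. \<open>mk_ell2\<close> is unspecified off square summable functions, so
  \<open>emb u\<close> has meaning only for \<open>u \<in> l2 m\<close>; the inverse
  \<open>prj\<close> is total and always lands in \<open>l2 m\<close>.\<close>

definition emb :: "('v \<Rightarrow> real) \<Rightarrow> 'v ell2" where
  "emb u = mk_ell2 (\<lambda>x. sqrt (m x) * u x)"

definition prj :: "'v ell2 \<Rightarrow> 'v \<Rightarrow> real" where
  "prj f x = coord f x / sqrt (m x)"

lemma coord_emb: "u \<in> l2 m \<Longrightarrow> coord (emb u) x = sqrt (m x) * u x"
  by (simp add: emb_def mk_ell2_inverse l2_def power_mult_distrib)

lemma m_prj_sq: "m x * (prj f x)\<^sup>2 = (coord f x)\<^sup>2"
  by (simp add: prj_def power_divide)

lemma prj_in_l2 [simp]: "prj f \<in> l2 m"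
  by (simp add: l2_def m_prj_sq coord_sq_summable)

lemma emb_prj [simp]: "emb (prj f) = f"
  by (rule ell2_eqI) (simp add: coord_emb, simp add: prj_def)

lemma prj_emb: "u \<in> l2 m \<Longrightarrow> prj (emb u) = u"
  by (simp add: fun_eq_iff prj_def coord_emb)

lemma sqrt_m_mult: "sqrt (m x) * r * (sqrt (m x) * s) = m x * r * s"
proof -
  have "sqrt (m x) * r * (sqrt (m x) * s) = (sqrt (m x) * sqrt (m x)) * r * s"
    by (simp only: ac_simps)
  then show ?thesis by (simp only: m_simps)
qed

lemma l2_inner_eq: "u \<in> l2 m \<Longrightarrow> v \<in> l2 m \<Longrightarrow> l2_inner m u v = emb u \<bullet> emb v"
  unfolding l2_inner_def inner_ell2_def 
  by (intro infsum_cong) (simp only: coord_emb sqrt_m_mult)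

lemma l2_norm_eq: "u \<in> l2 m \<Longrightarrow> l2_norm m u = norm (emb u)"
  by (simp add: norm_eq_sqrt_inner l2_norm_def l2_inner_def power2_eq_square mult.assoc flip: l2_inner_eq)

lemma prj_diff: "prj (f - g) x = prj f x - prj g x"
  and prj_add: "prj (f + g) x = prj f x + prj g x"
  and prj_scaleR: "prj (r *\<^sub>R f) x = r * prj f x"
  by (simp_all add: prj_def diff_divide_distrib add_divide_distrib)

lemma l2_diff:
  assumes "u \<in> l2 m" "v \<in> l2 m"
  shows "(\<lambda>x. u x - v x) \<in> l2 m" "emb (\<lambda>x. u x - v x) = emb u - emb v"
proof -
  have eq: "(\<lambda>x. u x - v x) = prj (emb u - emb v)"
    using assms by (simp add: fun_eq_iff prj_diff prj_emb)
  show "(\<lambda>x. u x - v x) \<in> l2 m" "emb (\<lambda>x. u x - v x) = emb u - emb v"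
    unfolding eq by simp_all
qed

lemma fin_supp_l2: "fin_supp u \<Longrightarrow> u \<in> l2 m"
  unfolding l2_def fin_supp_def mem_Collect_eq
  by (rule finite_nonzero_values_imp_summable_on) (erule rev_finite_subset, auto)

section \<open>The Laplacian as a bounded operator\<close>

definition diag :: "'v ell2 \<Rightarrow> 'v ell2" where
  "diag f = mk_ell2 (\<lambda>x. deg b c m x * coord f x)"

definition adj :: "'v ell2 \<Rightarrow> 'v ell2" where
  "adj f = mk_ell2 (\<lambda>x. (\<Sum>y\<in>nbr x. b x y * prj f y) / sqrt (m x))"

definition lap :: "'v ell2 \<Rightarrow> 'v ell2" where
  "lap f = diag f - adj f"

lemma sum_deg_sq_le:
  assumes "finite F"
  shows "(\<Sum>x\<in>F. (deg b c m x * coord f x)\<^sup>2) \<le> (M * norm f)\<^sup>2"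
proof -
  have "(\<Sum>x\<in>F. (deg b c m x * coord f x)\<^sup>2) \<le> (\<Sum>x\<in>F. M\<^sup>2 * (coord f x)\<^sup>2)"
    unfolding power_mult_distrib
    by (intro sum_mono mult_right_mono power_mono deg_le) auto
  also have "\<dots> \<le> (M * norm f)\<^sup>2"
    using sum_coord_sq_le [OF assms, of f]
    by (simp add: power_mult_distrib mult_left_mono flip: sum_distrib_left)
  finally show ?thesis .
qed

text \<open>Schur's test: Cauchy--Schwarz with weights \<open>b x y\<close> uses
  \<open>wt x \<le> M * m x\<close> once, and exchanging the sums uses it again at \<open>y\<close>.
  The bound is on finite sums because it must first show that \<open>adj f\<close> is square
  summable, without which \<open>coord (adj f)\<close> is unspecified.\<close>

lemma sum_adj_sq_le:
  assumes F: "finite F"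
  shows "(\<Sum>x\<in>F. ((\<Sum>y\<in>nbr x. b x y * prj f y) / sqrt (m x))\<^sup>2) \<le> (M * norm f)\<^sup>2"
proof -
  let ?u = "prj f"
  define G where "G = (\<Union>x\<in>F. nbr x)"
  have G: "finite G" using F by (simp add: G_def)
  have "((\<Sum>y\<in>nbr x. b x y * ?u y) / sqrt (m x))\<^sup>2 \<le> M * (\<Sum>y\<in>nbr x. b x y * (?u y)\<^sup>2)" for x
  proof -
    let ?S = "\<Sum>y\<in>nbr x. b x y * (?u y)\<^sup>2"
    have S: "0 \<le> ?S" by (simp add: sum_nonneg)
    have "(\<Sum>y\<in>nbr x. b x y * ?u y)\<^sup>2 = (\<Sum>y\<in>nbr x. sqrt (b x y) * (sqrt (b x y) * ?u y))\<^sup>2"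
      by (simp flip: mult.assoc)
    also have "\<dots> \<le> (\<Sum>y\<in>nbr x. (sqrt (b x y))\<^sup>2) * (\<Sum>y\<in>nbr x. (sqrt (b x y) * ?u y)\<^sup>2)"
      by (rule Cauchy_Schwarz_ineq_sum)
    also have "\<dots> = wt x * ?S"
      by (simp add: power_mult_distrib wt_def)
    also have "\<dots> \<le> M * m x * ?S"
      by (intro mult_right_mono wt_le S)
    finally show ?thesis by (simp add: power_divide divide_le_eq mult_ac)
  qed
  then have "(\<Sum>x\<in>F. ((\<Sum>y\<in>nbr x. b x y * ?u y) / sqrt (m x))\<^sup>2)
      \<le> (\<Sum>x\<in>F. M * (\<Sum>y\<in>nbr x. b x y * (?u y)\<^sup>2))"
    by (rule sum_mono)
  also have "\<dots> \<le> (\<Sum>x\<in>F. M * (\<Sum>y\<in>G. b x y * (?u y)\<^sup>2))"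
    using G by (intro sum_mono mult_left_mono sum_mono2 M_nonneg) (auto simp: G_def)
  also have "\<dots> = M * (\<Sum>y\<in>G. (\<Sum>x\<in>F. b x y) * (?u y)\<^sup>2)"
    by (simp add: sum_distrib_left sum_distrib_right sum.swap [of _ G F])
  also have "\<dots> \<le> M * (\<Sum>y\<in>G. M * (coord f y)\<^sup>2)"
  proof (intro mult_left_mono sum_mono M_nonneg)
    fix y
    have "(\<Sum>x\<in>F. b x y) \<le> wt y"
      using sum_b_le [OF F, of y] by (simp add: b_sym)
    then have "(\<Sum>x\<in>F. b x y) * (?u y)\<^sup>2 \<le> M * m y * (?u y)\<^sup>2"
      using wt_le [of y] by (intro mult_right_mono) auto
    also have "\<dots> = M * (coord f y)\<^sup>2" by (simp only: mult.assoc m_prj_sq)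
    finally show "(\<Sum>x\<in>F. b x y) * (?u y)\<^sup>2 \<le> M * (coord f y)\<^sup>2" .
  qed
  also have "\<dots> = M\<^sup>2 * (\<Sum>y\<in>G. (coord f y)\<^sup>2)"
    by (simp add: power2_eq_square mult.assoc flip: sum_distrib_left)
  also have "\<dots> \<le> M\<^sup>2 * (norm f)\<^sup>2"
    by (intro mult_left_mono sum_coord_sq_le G) simp
  also have "\<dots> = (M * norm f)\<^sup>2"
    by (simp only: power_mult_distrib)
  finally show ?thesis .
qed

lemma coord_diag: "coord (diag f) x = deg b c m x * coord f x"
  unfolding diag_def
  by (subst mk_ell2_inverse) (auto intro: sq_summable_if_bounded sum_deg_sq_le)

lemma coord_adj: "coord (adj f) x = (\<Sum>y\<in>nbr x. b x y * prj f y) / sqrt (m x)"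
  unfolding adj_def
  by (subst mk_ell2_inverse) (auto intro: sq_summable_if_bounded sum_adj_sq_le)

lemma norm_diag_le: "norm (diag f) \<le> M * norm f"
  by (rule power2_le_imp_le [OF norm_ell2_sq_leI])
    (simp_all only: coord_diag sum_deg_sq_le mult_nonneg_nonneg M_nonneg norm_ge_zero)

lemma norm_adj_le: "norm (adj f) \<le> M * norm f"
  by (rule power2_le_imp_le [OF norm_ell2_sq_leI])
    (simp_all only: coord_adj sum_adj_sq_le mult_nonneg_nonneg M_nonneg norm_ge_zero)

lemma bounded_linear_lap: "bounded_linear lap"
proof -
  have "bounded_linear diag"
  proof (rule bounded_linear_intro)
    show "norm (diag f) \<le> norm f * M" for f
      using norm_diag_le by (simp add: mult.commute)
  qed (auto intro!: ell2_eqI simp: coord_diag algebra_simps)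
  moreover have "bounded_linear adj"
  proof (rule bounded_linear_intro)
    show "norm (adj f) \<le> norm f * M" for f
      using norm_adj_le by (simp add: mult.commute)
  qed (auto intro!: ell2_eqI simp: coord_adj prj_add prj_scaleR distrib_left sum.distrib
        add_divide_distrib sum_distrib_left mult_ac)
  ultimately show ?thesis
    unfolding lap_def [abs_def] by (rule bounded_linear_sub)
qed

lemma coord_lap:
  "coord (lap f) x = ((\<Sum>y\<in>nbr x. b x y * (prj f x - prj f y)) + c x * prj f x) / sqrt (m x)"
proof -
  have "deg b c m x * coord f x = (wt x + c x) * prj f x / sqrt (m x)"
    unfolding deg_eq by (simp add: prj_def)
  then show ?thesis
    by (simp add: lap_def coord_diag coord_adj wt_def right_diff_distrib sum_subtractf
        sum_distrib_right diff_divide_distrib add_divide_distrib distrib_right)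
qed

lemma local_op_lap: "local_op lap"
  unfolding local_op_def
proof (intro allI impI)
  fix K :: "'v set" assume K: "finite K"
  have "coord (lap f) x = 0" if "f \<in> vanish (K \<union> (\<Union>x\<in>K. nbr x))" "x \<in> K" for f x
  proof -
    have "prj f y = 0" if "y \<in> insert x (nbr x)" for y
      using that \<open>f \<in> _\<close> \<open>x \<in> K\<close> by (auto simp: prj_def vanish_def)
    then show ?thesis by (simp add: coord_lap)
  qed
  then have "lap ` vanish (K \<union> (\<Union>x\<in>K. nbr x)) \<subseteq> vanish K"
    by (auto simp: vanish_def)
  with K show "\<exists>K'. finite K' \<and> K \<subseteq> K' \<and> lap ` vanish K' \<subseteq> vanish K"
    by (intro exI [of _ "K \<union> (\<Union>x\<in>K. nbr x)"]) auto
qed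

lemma summable_b_sq: "(\<lambda>(x, y). b x y * (prj f x)\<^sup>2) summable_on UNIV \<times> UNIV"
proof (rule summable_on_SigmaI)
  show "((\<lambda>y. case (x, y) of (x, y) \<Rightarrow> b x y * (prj f x)\<^sup>2) has_sum wt x * (prj f x)\<^sup>2) UNIV" for x
    using has_sum_nbr [of x "\<lambda>_. (prj f x)\<^sup>2"] by (simp add: wt_def sum_distrib_right)
  show "(\<lambda>x. wt x * (prj f x)\<^sup>2) summable_on UNIV"
  proof (rule summable_on_comparison_test)
    show "(\<lambda>x. M * (coord f x)\<^sup>2) summable_on UNIV"
      by (intro summable_on_cmult_right coord_sq_summable)
    show "wt x * (prj f x)\<^sup>2 \<le> M * (coord f x)\<^sup>2" for x
      using mult_right_mono [OF wt_le [of x], of "(prj f x)\<^sup>2"] by (simp only: mult.assoc m_prj_sq zero_le_power2)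
  qed auto
qed auto

lemma summable_swap: "(\<lambda>(x, y). F x y) summable_on UNIV \<times> UNIV \<Longrightarrow>
    (\<lambda>(x, y). F y x :: real) summable_on UNIV \<times> UNIV"
  using summable_on_swap [of "\<lambda>(x, y). F x y" UNIV UNIV] by (simp add: case_prod_unfold)

lemma summable_real_if_bound:
  fixes g h :: "'a \<Rightarrow> real"
  assumes "h summable_on A" "\<And>x. x \<in> A \<Longrightarrow> \<bar>g x\<bar> \<le> h x"
  shows "g summable_on A"
proof -
  have "(\<lambda>x. \<bar>g x\<bar>) summable_on A"
    using assms by (intro summable_on_comparison_test [OF assms(1)]) auto
  then show ?thesis by (subst summable_on_iff_abs_summable_on_real) simp
qed

text \<open>Summation by parts. By symmetry of \<open>b\<close> the summand of the form is
  \<open>F x y + F y x\<close>, and both halves have the same sum. Splitting and iterating the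
  double sum requires absolute convergence, which follows from the majorant with
  \<open>(u x)\<^sup>2\<close>, \<open>(u y)\<^sup>2\<close> and
  \<open>(v x)\<^sup>2\<close>.\<close>

lemma green: "Qbil b c (prj f) (prj g) = lap f \<bullet> g"
proof -
  let ?u = "prj f" and ?v = "prj g"
  define F where "F x y = b x y * (?u x - ?u y) * ?v x" for x y
  have "(\<lambda>z. (case z of (x, y) \<Rightarrow> b x y * (?u x)\<^sup>2) + (case z of (x, y) \<Rightarrow> b y x * (?u y)\<^sup>2)
      + (case z of (x, y) \<Rightarrow> b x y * (?v x)\<^sup>2)) summable_on UNIV \<times> UNIV"
    by (intro summable_on_add summable_b_sq summable_swap)
  then have sumF: "(\<lambda>(x, y). F x y) summable_on UNIV \<times> UNIV"
  proof (rule summable_real_if_bound)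
    fix z :: "'v \<times> 'v"
    obtain x y where z: "z = (x, y)" by force
    have "\<bar>(?u x - ?u y) * ?v x\<bar> \<le> (?u x)\<^sup>2 + (?u y)\<^sup>2 + (?v x)\<^sup>2"
    proof -
      have "2 * (\<bar>?u x - ?u y\<bar> * \<bar>?v x\<bar>) \<le> (?u x - ?u y)\<^sup>2 + (?v x)\<^sup>2"
        using sum_squares_bound [of "\<bar>?u x - ?u y\<bar>" "\<bar>?v x\<bar>"] by simp
      moreover have "(?u x - ?u y)\<^sup>2 \<le> 2 * (?u x)\<^sup>2 + 2 * (?u y)\<^sup>2"
        using zero_le_power2 [of "?u x + ?u y"] by (simp add: power2_sum power2_diff)
      moreover have "0 \<le> (?v x)\<^sup>2" by simp
      ultimately show ?thesis unfolding abs_mult by linarith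
    qed
    from mult_left_mono [OF this b_nonneg [of x y]]
    show "\<bar>case z of (x, y) \<Rightarrow> F x y\<bar> \<le> (case z of (x, y) \<Rightarrow> b x y * (?u x)\<^sup>2)
        + (case z of (x, y) \<Rightarrow> b y x * (?u y)\<^sup>2) + (case z of (x, y) \<Rightarrow> b x y * (?v x)\<^sup>2)"
      by (simp add: z F_def abs_mult mult.assoc distrib_left b_sym [of y x])
  qed
  define G where "G x = (\<Sum>y\<in>nbr x. b x y * (?u x - ?u y)) * ?v x" for x
  have G: "(\<Sum>\<^sub>\<infinity>y. F x y) = G x" for x
    using infsumI [OF has_sum_nbr [of x "\<lambda>y. (?u x - ?u y) * ?v x"]]
    by (simp add: F_def G_def sum_distrib_right mult.assoc)
  have sumG: "G summable_on UNIV" "infsum (\<lambda>(x, y). F x y) UNIV = infsum G UNIV"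
    using infsum_Sigma'_banach [of F UNIV "\<lambda>_. UNIV"] summable_on_Sigma_banach [of F UNIV "\<lambda>_. UNIV"] sumF
    by (simp_all add: G [abs_def])
  have swapF: "infsum (\<lambda>(x, y). F y x) UNIV = infsum (\<lambda>(x, y). F x y) UNIV"
    using infsum_reindex_bij_betw [of prod.swap UNIV UNIV "\<lambda>(x, y). F x y"]
    by (simp add: case_prod_unfold bij_betw_def)
  have "(\<Sum>\<^sub>\<infinity>(x, y). b x y * (?u x - ?u y) * (?v x - ?v y))
      = (\<Sum>\<^sub>\<infinity>z. (case z of (x, y) \<Rightarrow> F x y) + (case z of (x, y) \<Rightarrow> F y x))"
    by (intro infsum_cong) (auto simp: F_def b_sym algebra_simps)
  also have "\<dots> = 2 * infsum G UNIV"
    using sumF summable_swap [OF sumF] by (subst infsum_add) (simp_all add: swapF sumG(2))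
  finally have 1: "(\<Sum>\<^sub>\<infinity>(x, y). b x y * (?u x - ?u y) * (?v x - ?v y)) = 2 * infsum G UNIV" .
  have sumc: "(\<lambda>x. c x * ?u x * ?v x) summable_on UNIV"
  proof (rule summable_real_if_bound)
    show "(\<lambda>x. M * ((coord f x)\<^sup>2 + (coord g x)\<^sup>2)) summable_on UNIV"
      by (intro summable_on_cmult_right summable_on_add coord_sq_summable)
    fix x
    have "2 * (\<bar>?u x\<bar> * \<bar>?v x\<bar>) \<le> (?u x)\<^sup>2 + (?v x)\<^sup>2"
      using sum_squares_bound [of "\<bar>?u x\<bar>" "\<bar>?v x\<bar>"] by simp
    moreover have "0 \<le> \<bar>?u x\<bar> * \<bar>?v x\<bar>" by simp
    ultimately have "\<bar>?u x\<bar> * \<bar>?v x\<bar> \<le> (?u x)\<^sup>2 + (?v x)\<^sup>2" by linarith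
    then have "\<bar>c x * ?u x * ?v x\<bar> \<le> c x * ((?u x)\<^sup>2 + (?v x)\<^sup>2)"
      by (simp add: abs_mult mult.assoc mult_left_mono)
    also have "\<dots> \<le> M * m x * ((?u x)\<^sup>2 + (?v x)\<^sup>2)"
      by (intro mult_right_mono c_le) simp
    also have "\<dots> = M * ((coord f x)\<^sup>2 + (coord g x)\<^sup>2)"
      by (simp only: mult.assoc distrib_left m_prj_sq)
    finally show "\<bar>c x * ?u x * ?v x\<bar> \<le> M * ((coord f x)\<^sup>2 + (coord g x)\<^sup>2)" .
  qed
  have "Qbil b c ?u ?v = infsum G UNIV + (\<Sum>\<^sub>\<infinity>x. c x * ?u x * ?v x)"
    by (simp add: Qbil_def 1)
  also have "\<dots> = (\<Sum>\<^sub>\<infinity>x. G x + c x * ?u x * ?v x)"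
    by (rule infsum_add [symmetric]) fact+
  also have "\<dots> = lap f \<bullet> g"
    unfolding inner_ell2_def
    by (intro infsum_cong) (simp add: coord_lap G_def prj_def [of g] field_simps)
  finally show ?thesis .
qed

lemma Qbil_eq: "u \<in> l2 m \<Longrightarrow> v \<in> l2 m \<Longrightarrow> Qbil b c u v = lap (emb u) \<bullet> emb v"
  using green [of "emb u" "emb v"] by (simp add: prj_emb)

lemma Qbil_commute: "Qbil b c u v = Qbil b c v u"
  by (simp add: Qbil_def mult_ac)

lemma symmetric_op_lap: "symmetric_op lap"
  unfolding symmetric_op_def
proof (intro allI)
  fix f g :: "'v ell2"
  have "lap f \<bullet> g = lap g \<bullet> f"
    unfolding green [symmetric] by (rule Qbil_commute)
  then show "lap f \<bullet> g = f \<bullet> lap g" by (simp add: inner_commute)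
qed

lemma Qmax_eq: "u \<in> l2 m \<Longrightarrow> Qmax b c u = lap (emb u) \<bullet> emb u"
  by (simp add: Qbil_eq [symmetric] Qbil_def Qmax_def power2_eq_square mult.assoc)

section \<open>The closed form and its associated operator\<close>

lemma approx_seq_tendsto:
  assumes "approx_seq b c m \<phi> u" "u \<in> l2 m"
  shows "(\<lambda>n. emb (\<phi> n)) \<longlonglongrightarrow> emb u" "\<phi> n \<in> l2 m"
proof -
  have \<phi>: "\<phi> n \<in> l2 m" for n
    using assms(1) by (simp add: approx_seq_def fin_supp_l2)
  then show "\<phi> n \<in> l2 m" .
  have "(\<lambda>n. norm (emb (\<phi> n) - emb u)) \<longlonglongrightarrow> 0"
    using assms(1) l2_norm_eq [OF l2_diff(1) [OF \<phi> assms(2)]] l2_diff(2) [OF \<phi> assms(2)]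
    by (simp add: approx_seq_def)
  then show "(\<lambda>n. emb (\<phi> n)) \<longlonglongrightarrow> emb u"
    by (simp add: tendsto_norm_zero_iff LIM_zero_iff)
qed

text \<open>Truncations to finite sets converge in norm, and boundedness of \<open>lap\<close> turns
  this into the Cauchy property for \<open>Qmax\<close>. Hence the closure is defined on all of
  \<open>l2 m\<close>.\<close>

lemma approx_seq_exists:
  assumes u: "u \<in> l2 m"
  shows "\<exists>\<phi>. approx_seq b c m \<phi> u"
proof -
  obtain K where K: "\<And>n. finite (K n)" "\<And>n. norm (cut (- K n) (emb u)) \<le> inverse (real (Suc n))"
    using norm_cut_tail [of "inverse (real (Suc _))" "emb u"] by (metis inverse_positive_iff_positive of_nat_0_less_iff zero_less_Suc)
  define p where "p n = cut (K n) (emb u)" for n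
  have pu: "p n - emb u = - cut (- K n) (emb u)" for n
    unfolding p_def by (subst (2) cut_split [of "emb u" "K n"]) simp
  have "(\<lambda>n. norm (p n - emb u)) \<longlonglongrightarrow> 0"
    by (rule tendsto_sandwich [OF _ _ tendsto_const LIMSEQ_inverse_real_of_nat])
      (use K(2) in \<open>auto simp: pu intro!: always_eventually\<close>)
  then have lim: "p \<longlonglongrightarrow> emb u" by (simp add: tendsto_norm_zero_iff LIM_zero_iff)
  obtain C where C: "C > 0" "\<And>f. norm (lap f) \<le> C * norm f"
    using bounded_linear_bound [OF bounded_linear_lap] by metis
  have "fin_supp (prj (p n))" for n
    unfolding fin_supp_def p_def by (rule finite_subset [OF _ K(1)]) (auto simp: prj_def split: if_splits)
  moreover have "(\<lambda>n. l2_norm m (\<lambda>x. prj (p n) x - u x)) \<longlonglongrightarrow> 0"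
    using \<open>(\<lambda>n. norm (p n - emb u)) \<longlonglongrightarrow> 0\<close> by (simp add: l2_norm_eq l2_diff u)
  moreover have "\<exists>N. \<forall>n\<ge>N. \<forall>k\<ge>N. Qmax b c (\<lambda>x. prj (p n) x - prj (p k) x) < e" if e: "e > 0" for e
  proof -
    have "Cauchy p" using lim by (rule LIMSEQ_imp_Cauchy)
    moreover have "sqrt (e / C) > 0" using e C(1) by simp
    ultimately obtain N where N: "\<And>n k. n \<ge> N \<Longrightarrow> k \<ge> N \<Longrightarrow> norm (p n - p k) < sqrt (e / C)"
      unfolding Cauchy_def dist_norm by metis
    have "Qmax b c (\<lambda>x. prj (p n) x - prj (p k) x) < e" if nk: "n \<ge> N" "k \<ge> N" for n k
    proof -
      let ?d = "p n - p k"
      have "Qmax b c (\<lambda>x. prj (p n) x - prj (p k) x) = lap ?d \<bullet> ?d"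
        by (simp add: Qmax_eq l2_diff)
      also have "\<dots> \<le> norm (lap ?d) * norm ?d" by (rule norm_cauchy_schwarz)
      also have "\<dots> \<le> C * (norm ?d)\<^sup>2"
        using mult_right_mono [OF C(2) [of ?d], of "norm ?d"] by (simp add: power2_eq_square mult.assoc)
      also have "\<dots> < C * (sqrt (e / C))\<^sup>2"
        using N [OF nk] C(1) by (intro mult_strict_left_mono power_strict_mono) auto
      also have "\<dots> = e" using e C(1) by simp
      finally show ?thesis .
    qed
    then show ?thesis by blast
  qed
  ultimately have "approx_seq b c m (\<lambda>n. prj (p n)) u"
    unfolding approx_seq_def by blast
  then show ?thesis by blast
qed

lemma form_dom_eq: "form_dom b c m = l2 m"
  using approx_seq_exists by (auto simp: form_dom_def)

lemma Qform_eq: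
  assumes u: "u \<in> l2 m" and v: "v \<in> l2 m"
  shows "Qform b c m u v = lap (emb u) \<bullet> emb v"
proof -
  interpret T: bounded_linear lap by (rule bounded_linear_lap)
  have lim: "(\<lambda>n. Qbil b c (\<phi> n) (\<psi> n)) \<longlonglongrightarrow> lap (emb u) \<bullet> emb v"
    if "approx_seq b c m \<phi> u" "approx_seq b c m \<psi> v" for \<phi> \<psi>
    using approx_seq_tendsto [OF that(1) u] approx_seq_tendsto [OF that(2) v]
    by (simp add: Qbil_eq tendsto_inner T.tendsto)
  show ?thesis
    unfolding Qform_def
  proof (rule the_equality)
    fix q assume q: "\<forall>\<phi> \<psi>. approx_seq b c m \<phi> u \<longrightarrow> approx_seq b c m \<psi> v \<longrightarrow>
      (\<lambda>n. Qbil b c (\<phi> n) (\<psi> n)) \<longlonglongrightarrow> q"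
    \<comment> \<open>Uniqueness of \<open>q\<close> would fail vacuously without at least one pair
      of approximating sequences.\<close>
    obtain \<phi> \<psi> where "approx_seq b c m \<phi> u" "approx_seq b c m \<psi> v"
      using approx_seq_exists u v by blast
    with q lim show "q = lap (emb u) \<bullet> emb v" using LIMSEQ_unique by blast
  qed (use lim in blast)
qed

lemma op_dom_eq: "op_dom b c m = l2 m"
proof -
  have "\<exists>w\<in>l2 m. \<forall>v\<in>l2 m. Qform b c m u v = l2_inner m w v" if "u \<in> l2 m" for u
    by (intro bexI [of _ "prj (lap (emb u))"]) (simp_all add: Qform_eq that l2_inner_eq)
  then show ?thesis by (auto simp: op_dom_def form_dom_eq)
qed

lemma Lop_eq:
  assumes u: "u \<in> l2 m"
  shows "Lop b c m u = prj (lap (emb u))"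
  unfolding Lop_def form_dom_eq
proof (rule the_equality)
  show "prj (lap (emb u)) \<in> l2 m \<and> (\<forall>v\<in>l2 m. Qform b c m u v = l2_inner m (prj (lap (emb u))) v)"
    by (simp add: Qform_eq u l2_inner_eq)
  fix w assume w: "w \<in> l2 m \<and> (\<forall>v\<in>l2 m. Qform b c m u v = l2_inner m w v)"
  let ?d = "emb w - lap (emb u)"
  have "Qform b c m u (prj ?d) = l2_inner m w (prj ?d)" using w by simp
  then have "?d \<bullet> ?d = 0"
    using w by (simp add: Qform_eq u l2_inner_eq inner_diff_left)
  then have "emb w = lap (emb u)" by simp
  then show "w = prj (lap (emb u))" using w prj_emb by metis
qed

section \<open>Transfer of the spectrum and the essential spectrum\<close>

lemma Lop_shift: "u \<in> l2 m \<Longrightarrow> (\<lambda>x. Lop b c m u x - t * u x) = prj (shift lap t (emb u))"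
  by (simp add: fun_eq_iff Lop_eq shift_def prj_diff prj_scaleR prj_emb)

lemma bij_emb: "bij_betw emb (l2 m) UNIV"
  by (rule bij_betw_byWitness [where f' = prj]) (auto simp: prj_emb)

lemma bij_prj: "bij_betw prj UNIV (l2 m)"
  by (rule bij_betw_byWitness [where f' = emb]) (auto simp: prj_emb)

lemma spectrum_eq: "spectrum_L b c m = spec lap"
proof -
  have "(bij_betw (\<lambda>u x. Lop b c m u x - t * u x) (l2 m) (l2 m) \<and>
      (\<exists>C. \<forall>u\<in>l2 m. l2_norm m u \<le> C * l2_norm m (\<lambda>x. Lop b c m u x - t * u x)))
      \<longleftrightarrow> bounded_below (shift lap t)" (is "?B \<and> ?N \<longleftrightarrow> _") for t
  proof
    assume "?B \<and> ?N"
    then obtain C where C: "\<And>u. u \<in> l2 m \<Longrightarrow> l2_norm m u \<le> C * l2_norm m (\<lambda>x. Lop b c m u x - t * u x)"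
      by blast
    \<comment> \<open>The given \<open>C\<close> need not be positive;
      \<open>\<bar>C\<bar> + 1\<close> can be inverted.\<close>
    have "norm f \<le> (\<bar>C\<bar> + 1) * norm (shift lap t f)" for f
    proof -
      have "norm f \<le> C * norm (shift lap t f)"
        using C [of "prj f"] by (simp add: Lop_shift l2_norm_eq)
      also have "\<dots> \<le> (\<bar>C\<bar> + 1) * norm (shift lap t f)"
        by (intro mult_right_mono) auto
      finally show ?thesis .
    qed
    then show "bounded_below (shift lap t)"
      unfolding bounded_below_def by (intro exI [of _ "1 / (\<bar>C\<bar> + 1)"]) (auto simp: field_simps)
  next
    assume bb: "bounded_below (shift lap t)"
    have "bij (shift lap t)"
      by (intro bounded_below_imp_bij bounded_linear_shift symmetric_op_shift
          bounded_linear_lap symmetric_op_lap bb)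
    then have "bij_betw (prj \<circ> (shift lap t \<circ> emb)) (l2 m) (l2 m)"
      by (intro bij_betw_trans [OF bij_betw_trans [OF bij_emb] bij_prj])
    then have ?B
      by (rule bij_betw_cong [THEN iffD1, rotated]) (simp add: Lop_shift)
    moreover obtain k where k: "k > 0" "\<And>f. k * norm f \<le> norm (shift lap t f)"
      using bb unfolding bounded_below_def by blast
    have "l2_norm m u \<le> (1 / k) * l2_norm m (\<lambda>x. Lop b c m u x - t * u x)" if "u \<in> l2 m" for u
      using k(1) k(2) [of "emb u"] that by (simp add: Lop_shift l2_norm_eq field_simps)
    then have ?N by blast
    ultimately show "?B \<and> ?N" by blast
  qed
  then show ?thesis by (simp add: spectrum_L_def spec_def op_dom_eq)
qed

lemma eigenspace_eq: "eigenspace_L b c m t = prj ` {f. shift lap t f = 0}"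
proof -
  have "(\<forall>x. Lop b c m u x = t * u x) \<longleftrightarrow> shift lap t (emb u) = 0" if u: "u \<in> l2 m" for u
  proof -
    have "(\<forall>x. Lop b c m u x = t * u x) \<longleftrightarrow> prj (shift lap t (emb u)) = prj 0"
      unfolding Lop_shift [OF u, symmetric] by (simp add: fun_eq_iff prj_def)
    also have "\<dots> \<longleftrightarrow> shift lap t (emb u) = 0" by (metis emb_prj)
    finally show ?thesis .
  qed
  then have "eigenspace_L b c m t = {u \<in> l2 m. shift lap t (emb u) = 0}"
    by (auto simp: eigenspace_L_def op_dom_eq)
  also have "\<dots> = prj ` {f. shift lap t f = 0}"
    by (auto simp: image_iff) (metis prj_emb)
  finally show ?thesis .
qed

end

text \<open>The spanning functions need not be square summable, so they have no counterpart in the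
  Hilbert space; the induction removes them one at a time.\<close>
lemma finite_dim_if_finite_function_span:
  fixes p :: "'a::real_vector \<Rightarrow> 'b \<Rightarrow> real"
  assumes add: "\<And>f g x. p (f + g) x = p f x + p g x" and scale: "\<And>r f x. p (r *\<^sub>R f) x = r * p f x"
    and inj: "inj p"
    and "finite F" "subspace E" "\<And>f. f \<in> E \<Longrightarrow> \<exists>a. p f = (\<lambda>x. \<Sum>h\<in>F. a h * h x)"
  shows "\<exists>B. finite B \<and> E \<subseteq> span B"
  using assms(4-6)
proof (induction F arbitrary: E)
  case empty
  have "p 0 = (\<lambda>x. 0)" using scale [of 0 0] by (simp add: fun_eq_iff)
  then have "f = 0" if "f \<in> E" for f
    using empty.prems(2) [OF that] inj by (simp add: inj_eq flip: \<open>p 0 = _\<close>)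
  then show ?case by (intro exI [of _ "{}"]) auto
next
  case (insert k F)
  \<comment> \<open>The part of \<open>E\<close> that does without \<open>k\<close> has codimension
    at most one, so a single extra vector \<open>f1\<close> suffices.\<close>
  define E0 where "E0 = {f \<in> E. \<exists>a. p f = (\<lambda>x. \<Sum>h\<in>F. a h * h x)}"
  have E0I: "f \<in> E0" if "f \<in> E" "p f = (\<lambda>x. \<Sum>h\<in>F. a h * h x)" for f a
    using that unfolding E0_def by blast
  have "subspace E0"
    unfolding subspace_def
  proof (intro conjI ballI allI)
    have "p 0 = (\<lambda>x. \<Sum>h\<in>F. 0 * h x)" using scale [of 0 0] by (simp add: fun_eq_iff)
    then show "0 \<in> E0"
      using insert.prems(1) unfolding E0_def by (auto simp: subspace_0 intro: exI [of _ "\<lambda>_. 0"])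
  next
    fix f g assume "f \<in> E0" "g \<in> E0"
    then obtain a a' where "f \<in> E" "g \<in> E" "p f = (\<lambda>x. \<Sum>h\<in>F. a h * h x)" "p g = (\<lambda>x. \<Sum>h\<in>F. a' h * h x)"
      unfolding E0_def by blast
    then have "f + g \<in> E" "p (f + g) = (\<lambda>x. \<Sum>h\<in>F. (a h + a' h) * h x)"
      using insert.prems(1) by (auto simp: fun_eq_iff add subspace_add distrib_right sum.distrib)
    then show "f + g \<in> E0" by (rule E0I)
  next
    fix f and r :: real assume "f \<in> E0"
    then obtain a where "f \<in> E" "p f = (\<lambda>x. \<Sum>h\<in>F. a h * h x)"
      unfolding E0_def by blast
    then have "r *\<^sub>R f \<in> E" "p (r *\<^sub>R f) = (\<lambda>x. \<Sum>h\<in>F. (r * a h) * h x)"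
      using insert.prems(1) by (auto simp: fun_eq_iff scale subspace_scale sum_distrib_left mult.assoc)
    then show "r *\<^sub>R f \<in> E0" by (rule E0I)
  qed
  moreover have "\<exists>a. p f = (\<lambda>x. \<Sum>h\<in>F. a h * h x)" if "f \<in> E0" for f
    using that by (simp add: E0_def)
  ultimately obtain B where B: "finite B" "E0 \<subseteq> span B"
    using insert.IH by blast
  show ?case
  proof (cases "E \<subseteq> E0")
    case True
    with B show ?thesis by blast
  next
    case False
    then obtain f1 where f1: "f1 \<in> E" "f1 \<notin> E0" by blast
    obtain a1 where a1: "p f1 = (\<lambda>x. \<Sum>h\<in>insert k F. a1 h * h x)"
      using insert.prems(2) [OF f1(1)] by blast
    have "a1 k \<noteq> 0"
    proof
      assume "a1 k = 0"
      then have "p f1 = (\<lambda>x. \<Sum>h\<in>F. a1 h * h x)" using a1 insert.hyps by simp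
      with f1 show False by (auto simp: E0_def)
    qed
    have "f \<in> span (insert f1 B)" if f: "f \<in> E" for f
    proof -
      obtain a where a: "p f = (\<lambda>x. \<Sum>h\<in>insert k F. a h * h x)"
        using insert.prems(2) [OF f] by blast
      \<comment> \<open>Subtracting this multiple of \<open>f1\<close> cancels the coefficient of
        \<open>k\<close>.\<close>
      define r where "r = a k / a1 k"
      let ?g = "f + (- r) *\<^sub>R f1"
      have "p ?g x = (\<Sum>h\<in>F. (a h - r * a1 h) * h x)" for x
      proof -
        have "p ?g x = (a k - r * a1 k) * k x + (\<Sum>h\<in>F. (a h - r * a1 h) * h x)"
          using insert.hyps unfolding add scale a a1
          by (simp add: algebra_simps sum_subtractf sum_distrib_left sum_negf)
        then show ?thesis using \<open>a1 k \<noteq> 0\<close> by (simp add: r_def)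
      qed
      then have "p ?g = (\<lambda>x. \<Sum>h\<in>F. (a h - r * a1 h) * h x)" by blast
      moreover have "?g \<in> E" by (intro subspace_add subspace_scale insert.prems(1) f f1(1))
      ultimately have "?g \<in> E0" by (rule E0I [rotated])
      then have "?g \<in> span (insert f1 B)" using B(2) span_mono [of B "insert f1 B"] by blast
      moreover have "r *\<^sub>R f1 \<in> span (insert f1 B)" by (intro span_scale span_base) simp
      ultimately have "?g + r *\<^sub>R f1 \<in> span (insert f1 B)" by (rule span_add)
      then show ?thesis by simp
    qed
    then show ?thesis using B(1) by (intro exI [of _ "insert f1 B"]) auto
  qed
qed

context bounded_graph
begin

lemma inj_prj: "inj prj"
  by (metis emb_prj injI)

lemma eigenspace_finite_dim_iff:
  "(\<exists>F. finite F \<and> (\<forall>u\<in>eigenspace_L b c m t. \<exists>a. u = (\<lambda>x. \<Sum>f\<in>F. a f * f x)))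
   \<longleftrightarrow> (\<exists>F. finite F \<and> {f. shift lap t f = 0} \<subseteq> span F)" (is "?L \<longleftrightarrow> ?R")
proof
  assume ?L
  then obtain F where F: "finite F" "\<And>f. shift lap t f = 0 \<Longrightarrow> \<exists>a. prj f = (\<lambda>x. \<Sum>h\<in>F. a h * h x)"
    unfolding eigenspace_eq by blast
  show ?R
  proof (rule finite_dim_if_finite_function_span [OF prj_add prj_scaleR inj_prj F(1)])
    show "subspace {f. shift lap t f = 0}"
      using bounded_linear_shift [OF bounded_linear_lap, THEN bounded_linear.linear]
      by (rule linear_subspace_kernel)
  qed (use F(2) in auto)
next
  assume ?R
  then obtain F where F: "finite F" "{f. shift lap t f = 0} \<subseteq> span F" by blast
  have "\<exists>a. prj f = (\<lambda>x. \<Sum>h\<in>prj ` F. a h * h x)" if "shift lap t f = 0" for f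
  proof -
    have "f \<in> span F" using F(2) that by blast
    then obtain a where a: "f = (\<Sum>h\<in>F. a h *\<^sub>R h)"
      unfolding span_finite [OF F(1)] by auto
    have "prj f x = (\<Sum>h\<in>F. a h * prj h x)" for x
      by (simp add: a prj_def bounded_linear.linear [OF bounded_linear_coord, THEN linear_sum] sum_divide_distrib)
    then have "prj f = (\<lambda>x. \<Sum>h\<in>prj ` F. a (emb h) * h x)"
      by (simp add: fun_eq_iff sum.reindex inj_on_subset [OF inj_prj])
    then show ?thesis by (rule exI [of _ "\<lambda>h. a (emb h)"])
  qed
  then have "\<forall>u\<in>eigenspace_L b c m t. \<exists>a. u = (\<lambda>x. \<Sum>f\<in>prj ` F. a f * f x)"
    unfolding eigenspace_eq by blast
  with F(1) show ?L by blast
qed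

lemma ess_spectrum_eq: "ess_spectrum_L b c m = ess_spec lap"
proof -
  have "{\<lambda>x. 0} = prj ` {0}" by (auto simp: prj_def)
  then have "eigenspace_L b c m t = {\<lambda>x. 0} \<longleftrightarrow> {f. shift lap t f = 0} = {0}" for t
    unfolding eigenspace_eq by (simp only: inj_image_eq_iff [OF inj_prj])
  then have "disc_spectrum_L b c m = disc_spec lap"
    unfolding disc_spectrum_L_def disc_spec_def spectrum_eq eigenspace_finite_dim_iff by simp
  then show ?thesis by (simp add: ess_spectrum_L_def ess_spec_def spectrum_eq)
qed

end

section \<open>Isoperimetric constants at infinity\<close>

text \<open>A discrete coarea argument: subtracting the minimum of \<open>g\<close> removes a point from its support.\<close>
lemma sum_min_le:
  fixes \<beta> :: "'a \<Rightarrow> 'a \<Rightarrow> real"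
  assumes "finite W" "\<And>x. x \<in> W \<Longrightarrow> 0 \<le> g x"
    "\<And>W'. W' \<subseteq> W \<Longrightarrow> (\<Sum>x\<in>W'. \<Sum>y\<in>W'. \<beta> x y) \<le> \<eta> * (\<Sum>x\<in>W'. w x)"
  shows "(\<Sum>x\<in>W. \<Sum>y\<in>W. \<beta> x y * min (g x) (g y)) \<le> \<eta> * (\<Sum>x\<in>W. w x * g x)"
  using assms
proof (induction W arbitrary: g rule: finite_psubset_induct)
  case (psubset W)
  show ?case
  proof (cases "W = {}")
    case False
    define a where "a = Min (g ` W)"
    have "a \<in> g ` W" unfolding a_def using psubset.hyps False by (intro Min_in) auto
    then obtain z where z: "z \<in> W" "g z = a" by auto
    have a: "0 \<le> a" "\<And>x. x \<in> W \<Longrightarrow> a \<le> g x"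
      using psubset.prems(1) [OF z(1)] z(2) psubset.hyps by (auto simp: a_def)
    define h where "h x = g x - a" for x
    have h: "h z = 0" "\<And>x. x \<in> W \<Longrightarrow> 0 \<le> h x" using z a by (auto simp: h_def)
    have min0: "min (h x) (h z) = 0" "min (h z) (h x) = 0" if "x \<in> W" for x
      using h(2) [OF that] h(1) by auto
    have IH: "(\<Sum>x\<in>W - {z}. \<Sum>y\<in>W - {z}. \<beta> x y * min (h x) (h y)) \<le> \<eta> * (\<Sum>x\<in>W - {z}. w x * h x)"
      using z h(2) psubset.prems(2) by (intro psubset.IH) auto
    have "(\<Sum>x\<in>W. \<Sum>y\<in>W. \<beta> x y * min (h x) (h y))
        = (\<Sum>x\<in>W - {z}. \<Sum>y\<in>W - {z}. \<beta> x y * min (h x) (h y))"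
    proof (rule sum.mono_neutral_cong_right)
      show "\<forall>x\<in>W - (W - {z}). (\<Sum>y\<in>W. \<beta> x y * min (h x) (h y)) = 0"
        by (auto intro!: sum.neutral simp: min0)
      show "(\<Sum>y\<in>W. \<beta> x y * min (h x) (h y)) = (\<Sum>y\<in>W - {z}. \<beta> x y * min (h x) (h y))"
        if "x \<in> W - {z}" for x
        using that psubset.hyps by (intro sum.mono_neutral_right) (auto simp: min0)
    qed (use psubset.hyps in auto)
    moreover have "(\<Sum>x\<in>W. w x * h x) = (\<Sum>x\<in>W - {z}. w x * h x)"
      using psubset.hyps h(1) by (intro sum.mono_neutral_right) auto
    ultimately have 1: "(\<Sum>x\<in>W. \<Sum>y\<in>W. \<beta> x y * min (h x) (h y)) \<le> \<eta> * (\<Sum>x\<in>W. w x * h x)"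
      using IH by simp
    have 2: "a * (\<Sum>x\<in>W. \<Sum>y\<in>W. \<beta> x y) \<le> a * (\<eta> * (\<Sum>x\<in>W. w x))"
      using psubset.prems(2) [of W] a(1) by (intro mult_left_mono) auto
    \<comment> \<open>The bottom layer of height \<open>a\<close> is paid for by the density of
      \<open>W\<close> itself, the remainder \<open>h\<close> by the induction hypothesis on
      \<open>W - {z}\<close>.\<close>
    have "min (g x) (g y) = a + min (h x) (h y)" for x y by (simp add: h_def min_def)
    then have "(\<Sum>x\<in>W. \<Sum>y\<in>W. \<beta> x y * min (g x) (g y))
        = a * (\<Sum>x\<in>W. \<Sum>y\<in>W. \<beta> x y) + (\<Sum>x\<in>W. \<Sum>y\<in>W. \<beta> x y * min (h x) (h y))"
      by (simp add: distrib_left sum.distrib sum_distrib_left mult.commute)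
    also have "\<dots> \<le> a * (\<eta> * (\<Sum>x\<in>W. w x)) + \<eta> * (\<Sum>x\<in>W. w x * h x)"
      using 1 2 by (rule add_mono [rotated])
    also have "\<dots> = \<eta> * (\<Sum>x\<in>W. w x * g x)"
      by (simp add: h_def right_diff_distrib sum_subtractf algebra_simps flip: sum_distrib_left)
    finally show ?thesis .
  qed simp
qed

text \<open>Young's inequality with unequal weights, where the large factor
  \<open>1 / (2 * s)\<close> is always placed on the smaller square. That is the term the coarea
  estimate can handle.\<close>

lemma abs_mult_le_min:
  fixes p q s :: real
  assumes "s > 0"
  shows "\<bar>p\<bar> * \<bar>q\<bar> \<le> s / 2 * (p\<^sup>2 + q\<^sup>2) + 1 / (2 * s) * min (p\<^sup>2) (q\<^sup>2)"
proof -
  have *: "\<bar>p\<bar> * \<bar>q\<bar> \<le> s / 2 * (p\<^sup>2 + q\<^sup>2) + 1 / (2 * s) * q\<^sup>2" for p q :: real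
  proof -
    have "2 * s * (\<bar>p\<bar> * \<bar>q\<bar>) \<le> s\<^sup>2 * p\<^sup>2 + q\<^sup>2"
      using sum_squares_bound [of "s * \<bar>p\<bar>" "\<bar>q\<bar>"] by (simp add: power_mult_distrib mult_ac)
    also have "\<dots> \<le> s\<^sup>2 * (p\<^sup>2 + q\<^sup>2) + q\<^sup>2" by (simp add: distrib_left)
    finally show ?thesis using assms by (simp add: field_simps power2_eq_square)
  qed
  show ?thesis
    using * [of p q] * [of q p] by (simp add: min_def mult.commute add.commute)
qed

context bounded_graph
begin

text \<open>The weight at each vertex of \<open>W\<close> splits into edges leaving \<open>W\<close>
  and edges inside. So an isoperimetric lower bound and a degree upper bound that almost agree leave
  little room for inner edges.\<close>

lemma boundary_size_inner_sum:
  assumes W: "finite W"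
  shows "boundary_size b c W + (\<Sum>x\<in>W. \<Sum>y\<in>W. b x y) = (\<Sum>x\<in>W. deg b c m x * m x)"
proof -
  have "(\<Sum>\<^sub>\<infinity>y\<in>UNIV - W. b x y) + (\<Sum>y\<in>W. b x y) = wt x" for x
    using infsum_Un_disjoint [of "b x" W "UNIV - W"] W summable_on_subset_banach [OF b_summable]
    by (simp add: infsum_b)
  then have "(\<Sum>x\<in>W. (\<Sum>\<^sub>\<infinity>y\<in>UNIV - W. b x y) + (\<Sum>y\<in>W. b x y) + c x) = (\<Sum>x\<in>W. deg b c m x * m x)"
    by (simp add: deg_eq)
  then show ?thesis by (simp add: boundary_size_def sum.distrib)
qed

lemma boundary_size_singleton: "boundary_size b c {x} / m x = deg b c m x"
  using boundary_size_inner_sum [of "{x}"] by simp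

lemma indicator_form:
  assumes W: "finite W"
  defines "f \<equiv> emb (\<lambda>x. if x \<in> W then 1 else 0)"
  shows "(norm f)\<^sup>2 = (\<Sum>x\<in>W. m x)" "lap f \<bullet> f = boundary_size b c W"
    "W \<inter> K = {} \<Longrightarrow> f \<in> vanish K"
proof -
  let ?u = "\<lambda>x. if x \<in> W then 1 else 0 :: real"
  have u: "?u \<in> l2 m"
    using W by (intro fin_supp_l2) (simp add: fin_supp_def)
  have f: "coord f x = sqrt (m x) * ?u x" for x
    unfolding f_def by (rule coord_emb [OF u])
  have "(norm f)\<^sup>2 = (\<Sum>\<^sub>\<infinity>x\<in>W. m x)"
    unfolding norm_ell2_sq by (intro infsum_cong_neutral) (auto simp: f)
  then show "(norm f)\<^sup>2 = (\<Sum>x\<in>W. m x)" using W by simp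
  have out: "(\<Sum>y\<in>nbr x. b x y * (1 - ?u y)) = (\<Sum>\<^sub>\<infinity>y\<in>UNIV - W. b x y)" for x
  proof -
    have "(\<Sum>y\<in>nbr x. b x y * (1 - ?u y)) = (\<Sum>\<^sub>\<infinity>y. b x y * (1 - ?u y))"
      using infsumI [OF has_sum_nbr] by (rule sym)
    also have "\<dots> = (\<Sum>\<^sub>\<infinity>y\<in>UNIV - W. b x y)"
      by (intro infsum_cong_neutral) auto
    finally show ?thesis .
  qed
  have pf: "prj f = ?u" unfolding f_def by (rule prj_emb [OF u])
  have "lap f \<bullet> f = (\<Sum>\<^sub>\<infinity>x\<in>W. (\<Sum>\<^sub>\<infinity>y\<in>UNIV - W. b x y) + c x)"
    unfolding inner_ell2_def
  proof (rule infsum_cong_neutral)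
    fix x assume "x \<in> UNIV \<inter> W"
    then show "coord (lap f) x * coord f x = (\<Sum>\<^sub>\<infinity>y\<in>UNIV - W. b x y) + c x"
      using out [of x] unfolding coord_lap pf f by simp
  qed (auto simp: f)
  then show "lap f \<bullet> f = boundary_size b c W"
    using W by (simp add: boundary_size_def sum.distrib)
  show "f \<in> vanish K" if "W \<inter> K = {}"
    using that by (auto simp: vanish_def f)
qed

text \<open>After \<open>abs_mult_le_min\<close> the square terms are absorbed by the degree bound
  \<open>M\<close> and the minima by \<open>sum_min_le\<close> with the squared function as
  \<open>g\<close>; \<open>dens\<close> enters for subsets of \<open>G - K\<close>. The parameter
  \<open>s\<close> balances the two errors.\<close>

lemma sum_edges_le:
  assumes dens: "\<And>W. finite W \<Longrightarrow> W \<inter> K = {} \<Longrightarrow> (\<Sum>x\<in>W. \<Sum>y\<in>W. b x y) \<le> \<eta> * (\<Sum>x\<in>W. m x)"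
    and \<eta>: "\<eta> \<ge> 0" and s: "s > 0" and f: "f \<in> vanish K" and G: "finite G"
  shows "(\<Sum>x\<in>G. \<Sum>y\<in>G. b x y * (\<bar>prj f x\<bar> * \<bar>prj f y\<bar>)) \<le> (s * M + \<eta> / (2 * s)) * (norm f)\<^sup>2"
proof -
  let ?u = "prj f"
  define W where "W = G - K"
  have W: "finite W" using G by (simp add: W_def)
  have u0: "?u x = 0" if "x \<in> K" for x using f that by (simp add: prj_def vanish_def)
  have "(\<Sum>x\<in>G. \<Sum>y\<in>G. b x y * (\<bar>?u x\<bar> * \<bar>?u y\<bar>)) = (\<Sum>x\<in>W. \<Sum>y\<in>W. b x y * (\<bar>?u x\<bar> * \<bar>?u y\<bar>))"
    using G u0 unfolding W_def
    by (intro sum.mono_neutral_cong_right) (auto intro!: sum.mono_neutral_right)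
  also have "\<dots> \<le> (\<Sum>x\<in>W. \<Sum>y\<in>W. b x y * (s / 2 * ((?u x)\<^sup>2 + (?u y)\<^sup>2) + 1 / (2 * s) * min ((?u x)\<^sup>2) ((?u y)\<^sup>2)))"
    by (intro sum_mono mult_left_mono abs_mult_le_min s b_nonneg)
  also have "\<dots> = s / 2 * (\<Sum>x\<in>W. \<Sum>y\<in>W. b x y * (?u x)\<^sup>2) + s / 2 * (\<Sum>x\<in>W. \<Sum>y\<in>W. b x y * (?u y)\<^sup>2)
      + 1 / (2 * s) * (\<Sum>x\<in>W. \<Sum>y\<in>W. b x y * min ((?u x)\<^sup>2) ((?u y)\<^sup>2))"
    unfolding sum_distrib_left sum.distrib [symmetric]
    by (intro sum.cong refl) (simp only: distrib_left mult.left_commute mult.assoc)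
  also have "(\<Sum>x\<in>W. \<Sum>y\<in>W. b x y * (?u y)\<^sup>2) = (\<Sum>x\<in>W. \<Sum>y\<in>W. b x y * (?u x)\<^sup>2)"
    by (subst sum.swap) (simp add: b_sym)
  also have "s / 2 * (\<Sum>x\<in>W. \<Sum>y\<in>W. b x y * (?u x)\<^sup>2) + s / 2 * (\<Sum>x\<in>W. \<Sum>y\<in>W. b x y * (?u x)\<^sup>2)
      + 1 / (2 * s) * (\<Sum>x\<in>W. \<Sum>y\<in>W. b x y * min ((?u x)\<^sup>2) ((?u y)\<^sup>2))
      \<le> s * (M * (norm f)\<^sup>2) + 1 / (2 * s) * (\<eta> * (norm f)\<^sup>2)"
  proof -
    have "(\<Sum>x\<in>W. \<Sum>y\<in>W. b x y * (?u x)\<^sup>2) \<le> (\<Sum>x\<in>W. M * (coord f x)\<^sup>2)"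
    proof (rule sum_mono)
      fix x
      have "(\<Sum>y\<in>W. b x y * (?u x)\<^sup>2) \<le> M * m x * (?u x)\<^sup>2"
        using sum_b_le [OF W, of x] wt_le [of x]
        unfolding sum_distrib_right [symmetric] by (intro mult_right_mono) auto
      then show "(\<Sum>y\<in>W. b x y * (?u x)\<^sup>2) \<le> M * (coord f x)\<^sup>2"
        by (simp only: mult.assoc m_prj_sq)
    qed
    also have "\<dots> \<le> M * (norm f)\<^sup>2"
      unfolding sum_distrib_left [symmetric] by (intro mult_left_mono sum_coord_sq_le W M_nonneg)
    finally have 1: "s * (\<Sum>x\<in>W. \<Sum>y\<in>W. b x y * (?u x)\<^sup>2) \<le> s * (M * (norm f)\<^sup>2)"
      using s by (intro mult_left_mono) auto
    have "(\<Sum>x\<in>W. \<Sum>y\<in>W. b x y * min ((?u x)\<^sup>2) ((?u y)\<^sup>2)) \<le> \<eta> * (\<Sum>x\<in>W. m x * (?u x)\<^sup>2)"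
      using W by (intro sum_min_le dens) (auto simp: W_def intro: finite_subset)
    also have "\<dots> \<le> \<eta> * (norm f)\<^sup>2"
      unfolding m_prj_sq by (intro mult_left_mono sum_coord_sq_le W \<eta>)
    finally have "1 / (2 * s) * (\<Sum>x\<in>W. \<Sum>y\<in>W. b x y * min ((?u x)\<^sup>2) ((?u y)\<^sup>2))
        \<le> 1 / (2 * s) * (\<eta> * (norm f)\<^sup>2)"
      using s by (intro mult_left_mono) auto
    with 1 show ?thesis by (simp only: field_sum_of_halves [symmetric] distrib_right)
  qed
  also have "\<dots> = (s * M + \<eta> / (2 * s)) * (norm f)\<^sup>2"
    by (simp add: distrib_right)
  finally show ?thesis .
qed

text \<open>The diagonal of \<open>lap - D\<close> is at most \<open>\<eta>\<close> in absolute
  value off \<open>K\<close>; the adjacency part is estimated by absolute values, so both signs of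
  the form are covered at once.\<close>

lemma lap_form_close:
  assumes dens: "\<And>W. finite W \<Longrightarrow> W \<inter> K = {} \<Longrightarrow> (\<Sum>x\<in>W. \<Sum>y\<in>W. b x y) \<le> \<eta> * (\<Sum>x\<in>W. m x)"
    and \<eta>: "\<eta> \<ge> 0" and s: "s > 0" and deg: "\<And>x. x \<notin> K \<Longrightarrow> \<bar>deg b c m x - D\<bar> \<le> \<eta>"
    and f: "f \<in> vanish K"
  shows "\<bar>shift lap D f \<bullet> f\<bar> \<le> (\<eta> + (s * M + \<eta> / (2 * s))) * (norm f)\<^sup>2" (is "_ \<le> ?d * _")
proof -
  let ?u = "prj f"
  let ?h = "\<lambda>x. coord (shift lap D f) x * coord f x"
  have h_le: "\<bar>?h x\<bar> \<le> \<eta> * (coord f x)\<^sup>2 + (\<Sum>y\<in>nbr x. b x y * (\<bar>?u x\<bar> * \<bar>?u y\<bar>))" for x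
  proof -
    have cf: "coord f x = sqrt (m x) * ?u x" by (simp add: prj_def)
    have "?h x = (deg b c m x - D) * (coord f x)\<^sup>2 - (\<Sum>y\<in>nbr x. b x y * ?u y) / sqrt (m x) * coord f x"
      by (simp add: shift_def lap_def coord_diag coord_adj algebra_simps power2_eq_square)
    also have "(\<Sum>y\<in>nbr x. b x y * ?u y) / sqrt (m x) * coord f x = (\<Sum>y\<in>nbr x. b x y * ?u y) * ?u x"
      by (simp add: cf)
    also have "\<dots> = (\<Sum>y\<in>nbr x. b x y * (?u x * ?u y))"
      unfolding sum_distrib_right by (simp add: mult_ac)
    finally have "\<bar>?h x\<bar> \<le> \<bar>(deg b c m x - D) * (coord f x)\<^sup>2\<bar> + \<bar>\<Sum>y\<in>nbr x. b x y * (?u x * ?u y)\<bar>"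
      by (simp only: abs_triangle_ineq4)
    also have "\<bar>(deg b c m x - D) * (coord f x)\<^sup>2\<bar> \<le> \<eta> * (coord f x)\<^sup>2"
      using deg [of x] f by (cases "x \<in> K") (auto simp: vanish_def abs_mult intro: mult_right_mono)
    also have "\<bar>\<Sum>y\<in>nbr x. b x y * (?u x * ?u y)\<bar> \<le> (\<Sum>y\<in>nbr x. b x y * (\<bar>?u x\<bar> * \<bar>?u y\<bar>))"
      by (rule order_trans [OF sum_abs]) (simp add: abs_mult)
    finally show ?thesis by simp
  qed
  have sumh: "(\<lambda>x. \<bar>?h x\<bar>) summable_on UNIV"
    using coord_mult_summable [of "shift lap D f" f] by (subst (asm) summable_on_iff_abs_summable_on_real) simp
  have "\<bar>shift lap D f \<bullet> f\<bar> \<le> (\<Sum>\<^sub>\<infinity>x. \<bar>?h x\<bar>)"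
    unfolding inner_ell2_def using norm_infsum_bound [of ?h UNIV] sumh by simp
  also have "\<dots> \<le> ?d * (norm f)\<^sup>2"
  proof (rule infsum_le_finite_sums [OF sumh])
    fix F :: "'v set" assume F: "finite F"
    \<comment> \<open>Adding all neighbours of \<open>F\<close> dominates the sum over edges by a
      sum over the square of \<open>G\<close>, the shape treated by
      \<open>sum_edges_le\<close>.\<close>
    define G where "G = F \<union> (\<Union>x\<in>F. nbr x)"
    have G: "finite G" using F by (simp add: G_def)
    have "(\<Sum>x\<in>F. \<bar>?h x\<bar>) \<le> (\<Sum>x\<in>F. \<eta> * (coord f x)\<^sup>2 + (\<Sum>y\<in>nbr x. b x y * (\<bar>?u x\<bar> * \<bar>?u y\<bar>)))"
      by (intro sum_mono h_le)
    also have "\<dots> = \<eta> * (\<Sum>x\<in>F. (coord f x)\<^sup>2) + (\<Sum>x\<in>F. \<Sum>y\<in>nbr x. b x y * (\<bar>?u x\<bar> * \<bar>?u y\<bar>))"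
      by (simp add: sum.distrib sum_distrib_left)
    also have "\<dots> \<le> \<eta> * (norm f)\<^sup>2 + (\<Sum>x\<in>G. \<Sum>y\<in>G. b x y * (\<bar>?u x\<bar> * \<bar>?u y\<bar>))"
    proof (intro add_mono mult_left_mono sum_coord_sq_le F \<eta>)
      have "(\<Sum>x\<in>F. \<Sum>y\<in>nbr x. b x y * (\<bar>?u x\<bar> * \<bar>?u y\<bar>)) \<le> (\<Sum>x\<in>F. \<Sum>y\<in>G. b x y * (\<bar>?u x\<bar> * \<bar>?u y\<bar>))"
        using G by (intro sum_mono sum_mono2) (auto simp: G_def)
      also have "\<dots> \<le> (\<Sum>x\<in>G. \<Sum>y\<in>G. b x y * (\<bar>?u x\<bar> * \<bar>?u y\<bar>))"
        using G by (intro sum_mono2) (auto simp: G_def intro!: sum_nonneg)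
      finally show "(\<Sum>x\<in>F. \<Sum>y\<in>nbr x. b x y * (\<bar>?u x\<bar> * \<bar>?u y\<bar>)) \<le> (\<Sum>x\<in>G. \<Sum>y\<in>G. b x y * (\<bar>?u x\<bar> * \<bar>?u y\<bar>))" .
    qed
    also have "\<dots> \<le> \<eta> * (norm f)\<^sup>2 + (s * M + \<eta> / (2 * s)) * (norm f)\<^sup>2"
      using sum_edges_le [OF dens \<eta> s f G] by simp
    also have "\<dots> = ?d * (norm f)\<^sup>2" by (simp only: distrib_right)
    finally show "(\<Sum>x\<in>F. \<bar>?h x\<bar>) \<le> ?d * (norm f)\<^sup>2" .
  qed
  finally show ?thesis .
qed

section \<open>Comparison of the constants at infinity\<close>

lemma alpha_le_deg: "x \<notin> K \<Longrightarrow> alpha b c m (UNIV - K) \<le> ereal (deg b c m x)"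
  unfolding alpha_def
  by (rule INF_lower2 [of "{x}"]) (auto simp: boundary_size_singleton)

lemma deg_le_Dsup: "x \<notin> K \<Longrightarrow> ereal (deg b c m x) \<le> Dsup b c m (UNIV - K)"
  unfolding Dsup_def by (rule SUP_upper) simp

text \<open>A vertex outside both finite sets gives the test set \<open>{x}\<close> for
  \<open>alpha\<close> and a term of \<open>Dsup\<close>.\<close>

lemma alpha_boundary_le_D_boundary:
  assumes "infinite (UNIV :: 'v set)"
  shows "alpha_boundary b c m \<le> D_boundary b c m"
  unfolding alpha_boundary_def D_boundary_def
proof (intro SUP_least INF_greatest)
  fix K K' :: "'v set" assume "K \<in> {K. finite K}" "K' \<in> {K. finite K}"
  then obtain x where "x \<notin> K \<union> K'"
    using ex_new_if_finite [OF assms, of "K \<union> K'"] by auto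
  then show "alpha b c m (UNIV - K) \<le> Dsup b c m (UNIV - K')"
    using alpha_le_deg [of x K] deg_le_Dsup [of x K'] by (auto intro: order_trans)
qed

text \<open>Infinitude excludes the value minus infinity, which \<open>Dsup\<close> takes on the
  empty set.\<close>

lemma D_boundary_real:
  assumes "infinite (UNIV :: 'v set)"
  shows "D_boundary b c m = ereal (real_of_ereal (D_boundary b c m))"
proof -
  have "0 \<le> D_boundary b c m"
    unfolding D_boundary_def
  proof (rule INF_greatest)
    fix K :: "'v set" assume "K \<in> {K. finite K}"
    then obtain x where "x \<notin> K" using ex_new_if_finite [OF assms, of K] by auto
    have "0 \<le> ereal (deg b c m x)" by simp
    also have "\<dots> \<le> Dsup b c m (UNIV - K)" by (rule deg_le_Dsup) fact
    finally show "0 \<le> Dsup b c m (UNIV - K)" .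
  qed
  moreover have "D_boundary b c m \<le> ereal M"
    unfolding D_boundary_def
    by (rule INF_lower2 [of "{}"]) (auto simp: Dsup_def deg_le intro: SUP_least)
  ultimately show ?thesis by (cases "D_boundary b c m") auto
qed

text \<open>Indicator functions turn the quotients in \<open>alpha\<close> into Rayleigh quotients.
  A real \<open>a\<close> strictly between the two sides is used because
  \<open>alpha_boundary\<close> is an extended real.\<close>

lemma persson_le_alpha_boundary:
  assumes inf: "infinite (UNIV :: 'v set)"
  shows "ereal (persson lap) \<le> alpha_boundary b c m"
proof (rule ccontr)
  assume "\<not> ?thesis"
  then obtain a where a: "alpha_boundary b c m < ereal a" "ereal a < ereal (persson lap)"
    using ereal_dense2 [of "alpha_boundary b c m" "ereal (persson lap)"] by (auto simp: not_le)
  have "persson lap \<le> a"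
  proof (rule persson_le [OF bounded_linear_lap inf])
    fix K :: "'v set" assume K: "finite K"
    then have "alpha b c m (UNIV - K) \<le> alpha_boundary b c m"
      unfolding alpha_boundary_def by (intro SUP_upper) simp
    with a(1) have "alpha b c m (UNIV - K) < ereal a" by simp
    then obtain W where W: "finite W" "W \<noteq> {}" "W \<subseteq> UNIV - K"
      "boundary_size b c W / (\<Sum>x\<in>W. m x) < a"
      unfolding alpha_def INF_less_iff by auto
    define f where "f = emb (\<lambda>x. if x \<in> W then 1 else 0)"
    have pos: "0 < (\<Sum>x\<in>W. m x)" using W by (intro sum_pos) auto
    have n: "(norm f)\<^sup>2 = (\<Sum>x\<in>W. m x)" "lap f \<bullet> f = boundary_size b c W" "f \<in> vanish K"
      using indicator_form(1,2) [OF W(1)] indicator_form(3) [OF W(1), of K] W(3) unfolding f_def by auto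
    have "f \<noteq> 0" using n(1) pos by auto
    moreover have "lap f \<bullet> f \<le> a * (norm f)\<^sup>2"
      using W(4) pos unfolding n by (simp add: field_simps)
    ultimately show "\<exists>f\<in>vanish K. f \<noteq> 0 \<and> lap f \<bullet> f \<le> a * (norm f)\<^sup>2"
      using n(3) by blast
  qed
  with a(2) show False by simp
qed

lemma vanishes_at_infinity_lap:
  assumes alpha: "alpha_boundary b c m = ereal D" and D: "D_boundary b c m = ereal D"
  shows "vanishes_at_infinity lap D"
proof (rule vanishes_at_infinity_if_form [OF bounded_linear_lap symmetric_op_lap local_op_lap])
  fix d :: real assume d: "d > 0"
  \<comment> \<open>With these choices each of \<open>\<eta>\<close>, \<open>s * M\<close> and
    \<open>\<eta> / (2 * s)\<close> is at most \<open>d / 4\<close>; \<open>M + 1\<close> avoids a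
    division by zero.\<close>
  define s where "s = d / (4 * (M + 1))"
  have s: "s > 0" "s * M \<le> d / 4"
    using d M_nonneg by (auto simp: s_def field_simps)
  define \<eta> where "\<eta> = min (d / 4) (s * d / 2)"
  have \<eta>: "\<eta> > 0" "\<eta> \<le> d / 4" "\<eta> / (2 * s) \<le> d / 4"
    using d s(1) by (auto simp: \<eta>_def min_def field_simps)
  \<comment> \<open>Half of \<open>\<eta>\<close> on each side, since the inner edge density is
    bounded by the distance between the two bounds.\<close>
  have "ereal (D - \<eta> / 2) < alpha_boundary b c m" "D_boundary b c m < ereal (D + \<eta> / 2)"
    using \<eta>(1) by (simp_all add: alpha D)
  then obtain K1 K2 where K: "finite K1" "ereal (D - \<eta> / 2) < alpha b c m (UNIV - K1)"
      "finite K2" "Dsup b c m (UNIV - K2) < ereal (D + \<eta> / 2)"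
    unfolding alpha_boundary_def D_boundary_def less_SUP_iff INF_less_iff by auto
  define K where "K = K1 \<union> K2"
  have bs: "(D - \<eta> / 2) * (\<Sum>x\<in>W. m x) \<le> boundary_size b c W" if W: "finite W" "W \<inter> K = {}" for W
  proof (cases "W = {}")
    case False
    have "ereal (D - \<eta> / 2) \<le> alpha b c m (UNIV - K1)" using K(2) by simp
    also have "\<dots> \<le> ereal (boundary_size b c W / (\<Sum>x\<in>W. m x))"
      unfolding alpha_def using W False by (intro INF_lower) (auto simp: K_def)
    finally have "D - \<eta> / 2 \<le> boundary_size b c W / (\<Sum>x\<in>W. m x)" by simp
    moreover have "0 < (\<Sum>x\<in>W. m x)" using W False by (intro sum_pos) auto
    ultimately show ?thesis by (simp add: field_simps)
  qed (simp add: boundary_size_def)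
  have deg_up: "deg b c m x \<le> D + \<eta> / 2" if "x \<notin> K" for x
  proof -
    have "ereal (deg b c m x) \<le> Dsup b c m (UNIV - K2)"
      using that by (intro deg_le_Dsup) (simp add: K_def)
    also have "\<dots> \<le> ereal (D + \<eta> / 2)" using K(4) by simp
    finally show ?thesis by simp
  qed
  have deg_low: "D - \<eta> / 2 \<le> deg b c m x" if "x \<notin> K" for x
  proof -
    have "D - \<eta> / 2 \<le> boundary_size b c {x} / m x"
      using bs [of "{x}"] that by (simp add: pos_le_divide_eq)
    then show ?thesis by (simp only: boundary_size_singleton)
  qed
  have dens: "(\<Sum>x\<in>W. \<Sum>y\<in>W. b x y) \<le> \<eta> * (\<Sum>x\<in>W. m x)" if W: "finite W" "W \<inter> K = {}" for W
  proof -
    have "(\<Sum>x\<in>W. deg b c m x * m x) \<le> (\<Sum>x\<in>W. (D + \<eta> / 2) * m x)"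
      using W(2) by (intro sum_mono mult_right_mono deg_up) auto
    also have "\<dots> = (D - \<eta> / 2) * (\<Sum>x\<in>W. m x) + \<eta> * (\<Sum>x\<in>W. m x)"
      unfolding sum_distrib_left [symmetric] by (simp add: algebra_simps)
    finally show ?thesis
      using bs [OF W] boundary_size_inner_sum [OF W(1)] by linarith
  qed
  have deg_close: "\<bar>deg b c m x - D\<bar> \<le> \<eta>" if "x \<notin> K" for x
    using deg_up [OF that] deg_low [OF that] \<eta>(1) by linarith
  have "\<bar>shift lap D f \<bullet> f\<bar> \<le> d * (norm f)\<^sup>2" if f: "f \<in> vanish K" for f
  proof -
    have "\<bar>shift lap D f \<bullet> f\<bar> \<le> (\<eta> + (s * M + \<eta> / (2 * s))) * (norm f)\<^sup>2"
      using \<eta>(1) by (intro lap_form_close [OF dens _ s(1) deg_close f]) auto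
    also have "\<dots> \<le> d * (norm f)\<^sup>2"
      using \<eta>(2,3) s(2) d by (intro mult_right_mono) auto
    finally show ?thesis .
  qed
  moreover have "finite K" using K by (simp add: K_def)
  ultimately show "\<exists>K. finite K \<and> (\<forall>f\<in>vanish K. \<bar>shift lap D f \<bullet> f\<bar> \<le> d * (norm f)\<^sup>2)" by blast
qed

lemma ess_spectrum_iff:
  assumes inf: "infinite (UNIV :: 'v set)"
  shows "ess_spectrum_L b c m = {real_of_ereal (D_boundary b c m)}
         \<longleftrightarrow> alpha_boundary b c m = D_boundary b c m"
proof
  let ?D = "real_of_ereal (D_boundary b c m)"
  assume "ess_spectrum_L b c m = {?D}"
  then have "persson lap = ?D"
    using persson_in_ess_spec [OF bounded_linear_lap inf symmetric_op_lap local_op_lap]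
    by (simp add: ess_spectrum_eq)
  then have "D_boundary b c m \<le> alpha_boundary b c m"
    using persson_le_alpha_boundary [OF inf] by (subst D_boundary_real [OF inf]) simp
  then show "alpha_boundary b c m = D_boundary b c m"
    using alpha_boundary_le_D_boundary [OF inf] by (rule antisym [rotated])
next
  assume "alpha_boundary b c m = D_boundary b c m"
  then show "ess_spectrum_L b c m = {real_of_ereal (D_boundary b c m)}"
    unfolding ess_spectrum_eq
    using D_boundary_real [OF inf]
    by (intro ess_spec_if_vanishes_at_infinity bounded_linear_lap symmetric_op_lap inf
        vanishes_at_infinity_lap) simp_all
qed

end

text \<open>Finiteness at infinity bounds the degrees off a finite set; the finitely many others
  enter through the maximum, which provides the constant \<open>M\<close> of
  \<open>bounded_graph\<close>.\<close>

lemma deg_bounded_if_D_boundary_finite: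
  assumes "D_boundary b c m < \<infinity>"
  shows "\<exists>M. \<forall>x. deg b c m x \<le> M"
proof -
  obtain K where K: "finite K" "Dsup b c m (UNIV - K) < \<infinity>"
    using assms unfolding D_boundary_def INF_less_iff by auto
  obtain r where r: "Dsup b c m (UNIV - K) \<le> ereal r"
    using K(2) by (cases "Dsup b c m (UNIV - K)") auto
  have "deg b c m x \<le> r" if "x \<notin> K" for x
  proof -
    have "ereal (deg b c m x) \<le> Dsup b c m (UNIV - K)"
      unfolding Dsup_def using that by (intro SUP_upper) simp
    with r have "ereal (deg b c m x) \<le> ereal r" by (rule order_trans [rotated])
    then show ?thesis by simp
  qed
  then have "deg b c m x \<le> Max (insert r (deg b c m ` K))" for x
    using K(1) by (cases "x \<in> K") (auto simp: Max_ge_iff)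
  then show ?thesis by blast
qed

theorem mainTheorem12:
  fixes b :: "'v \<Rightarrow> 'v \<Rightarrow> real" and c :: "'v \<Rightarrow> real" and m :: "'v \<Rightarrow> real"
  assumes "countable (UNIV :: 'v set)" and "infinite (UNIV :: 'v set)"
    and "weighted_graph b c" and "locally_finite b" and "vertex_measure m"
    and "D_boundary b c m < \<infinity>"
  shows "ess_spectrum_L b c m = {real_of_ereal (D_boundary b c m)}
         \<longleftrightarrow> alpha_boundary b c m = D_boundary b c m"
proof -
  obtain M where "\<And>x. deg b c m x \<le> M"
    using deg_bounded_if_D_boundary_finite [OF assms(6)] by blast
  with assms interpret bounded_graph b c m M
    by unfold_locales auto
  show ?thesis by (rule ess_spectrum_iff) fact
qed

end
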